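(* Assume that $K$ is a bounded nonnegative function on $\mathbb{R}^d$ with $\int_{\mathbb{R}^d}K(z)\,dz=1$, $\int_{\mathbb{R}^d}z_jK(z)\,dz=0$ for all $j\in\{1,\dots,d\}$, and $\int_{\mathbb{R}^d}\|z\|^2|K(z)|\,dz<\infty$. Let $x\in\mathbb{R}^d$ be such that $f(x)\neq 0$, and assume that $f$ is twice differentiable at $x$. Assume moreover that $$\frac{nh_n^{*d}}{v_n^2}\to\infty,\qquad v_nh_n^{*2}\to 0,\qquad \frac{v_n^2h_n^d}{h_n^{*d}}\to\infty .$$ Then, for any $\delta>0$, $$\lim_{n\to\infty}\frac{v_n^2}{nh_n^{*d}}\log\mathbb{P}\left(f(x)\notin\left[f_n^*(x)-\delta\frac{\sqrt{f_n(x)\kappa}}{v_n}\,;\,f_n^*(x)+\delta\frac{\sqrt{f_n(x)\kappa}}{v_n}\right]\right)=-\frac{\delta^2}{2}.$$ Moreover, if the additional condition $$\frac{nh_n^{*d}}{v_n^2\log(1/h_n^* )}\to\infty$$ holds, then the sequence of intervals $$\left[f_n^*(x)-\delta\frac{\sqrt{f_n(x)\kappa}}{v_n}\,;\,f_n^*(x)+\delta\frac{\sqrt{f_n(x)\kappa}}{v_n}\right]$$ is an asymptotic almost sure sequence of confidence intervals of $f(x)$.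
   Context: Setting: $d\geq 1$ is an integer and $X_1,X_2,\dots$ are independent identically distributed $\mathbb{R}^d$-valued random vectors, defined on a probability space $(\Omega,\mathcal{A},\mathbb{P})$, with bounded probability density $f$. The kernel $K$ is a bounded nonnegative function on $\mathbb{R}^d$ with $\int K=1$ and $\lim_{\|z\|\to\infty}K(z)=0$. $(h_n)$ and $(h_n^* )$ are sequences of positive real numbers with $h_n\to 0$, $h_n^*\to 0$. $(v_n)$ is a positive nonrandom sequence with $v_n\to\infty$. The kernel density estimators are $$f_n(x)=\frac{1}{nh_n^d}\sum_{j=1}^nK\left(\frac{x-X_j}{h_n}\right),\qquad f_n^*(x)=\frac{1}{nh_n^{*d}}\sum_{j=1}^nK\left(\frac{x-X_j}{h_n^*}\right),$$ and $\kappa=\int_{\mathbb{R}^d}K^2(z)\,dz$. A sequence $(D_n)$ of (random) confidence regions of an unknown parameter $\theta$ is an asymptotic almost sure sequence of confidence regions (intervals) of $\theta$ if there exists $\Omega_0\subset\Omega$ with $\mathbb{P}(\Omega_0)=1$ such that for every $\omega\in\Omega_0$ there is $N(\omega)$ such that $n\geq N(\omega)$ implies $\theta\in D_n(\omega)$. *)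

theory Defs
  imports "HOL-Probability.Probability"
begin

text \<open>Vectors of dimension d are rendered as \<open>real ^ 'd\<close>, with d = \<open>CARD('d)\<close> \<open>\<ge>\<close> 1.
  The sample is indexed from 1; the value of \<open>X 0\<close> is never used.\<close>

definition kde ::
  "(real ^ 'd \<Rightarrow> real) \<Rightarrow> (nat \<Rightarrow> real) \<Rightarrow> (nat \<Rightarrow> 'w \<Rightarrow> real ^ 'd) \<Rightarrow>
   nat \<Rightarrow> real ^ 'd \<Rightarrow> 'w \<Rightarrow> real"
  where "kde K h X n x \<omega> =
    1 / (real n * h n ^ CARD('d)) * (\<Sum>j = 1..n. K ((x - X j \<omega>) /\<^sub>R h n))"

definition kappa :: "(real ^ 'd \<Rightarrow> real) \<Rightarrow> real"
  where "kappa K = (LINT z|lborel. (K z)\<^sup>2)"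

definition conf_interval ::
  "(real ^ 'd \<Rightarrow> real) \<Rightarrow> (nat \<Rightarrow> real) \<Rightarrow> (nat \<Rightarrow> real) \<Rightarrow> (nat \<Rightarrow> real) \<Rightarrow>
   (nat \<Rightarrow> 'w \<Rightarrow> real ^ 'd) \<Rightarrow> real \<Rightarrow> real ^ 'd \<Rightarrow> nat \<Rightarrow> 'w \<Rightarrow> real set"
  where "conf_interval K h h' v X \<delta> x n \<omega> =
    {kde K h' X n x \<omega> - \<delta> * (sqrt (kde K h X n x \<omega> * kappa K) / v n) ..
     kde K h' X n x \<omega> + \<delta> * (sqrt (kde K h X n x \<omega> * kappa K) / v n)}"

definition as_confidence_regions :: "'w measure \<Rightarrow> 'b \<Rightarrow> (nat \<Rightarrow> 'w \<Rightarrow> 'b set) \<Rightarrow> bool"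
  where "as_confidence_regions M \<theta> D \<longleftrightarrow>
    (\<exists>\<Omega>\<^sub>0\<in>sets M. measure M \<Omega>\<^sub>0 = 1 \<and> (\<forall>\<omega>\<in>\<Omega>\<^sub>0. \<exists>N. \<forall>n\<ge>N. \<theta> \<in> D n \<omega>))"

text \<open>Twice Frechet differentiable at a point: differentiable on a neighbourhood, with
  the derivative, as a map into the bounded linear functions, differentiable at the point.\<close>

definition twice_differentiable_at ::
  "('a::real_normed_vector \<Rightarrow> 'b::real_normed_vector) \<Rightarrow> 'a \<Rightarrow> bool"
  where "twice_differentiable_at f x \<longleftrightarrow>
    (\<exists>f' :: 'a \<Rightarrow> 'a \<Rightarrow>\<^sub>L 'b.
       (\<forall>\<^sub>F y in nhds x. (f has_derivative blinfun_apply (f' y)) (at y)) \<and>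
       f' differentiable (at x))"

end

theory Submission imports Defs "HOL-Real_Asymp.Real_Asymp" begin

text \<open>
  Let \<open>a n = n * h' n ^ d / (v n)\<^sup>2\<close> and \<open>Y n = v n * (kde K h' X n x - f x)\<close>. By independence the
  Laplace transform of \<open>Y n\<close> is an \<open>n\<close>-th power, and a Taylor expansion of the exponential gives
  \<open>ln E[exp (l * a n * Y n)] / a n \<longlonglongrightarrow> kappa K * f x * l\<^sup>2 / 2\<close> for every real \<open>l\<close>; the bias is
  \<open>O((h' n)\<^sup>2)\<close> because \<open>f\<close> is twice differentiable at \<open>x\<close> and \<open>K\<close> is centred. Chernoff's inequality and
  exponential tilting then give the two Gaussian tail bounds for \<open>Y n\<close>. The random factor
  \<open>kde K h X n x\<close> in the width is within any \<open>\<epsilon>\<close> of \<open>f x\<close> up to probabilities that are negligible at speed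
  \<open>a n\<close>. Under the additional condition \<open>a n / ln n\<close> tends to infinity, and the Borel--Cantelli lemma applies.
\<close>

section \<open>Gaussian tail bounds from limits of normalised log-Laplace transforms\<close>

lemma ln_ratio_tendsto_less:
  fixes a m :: "nat \<Rightarrow> real"
  assumes a: "filterlim a at_top sequentially" and m: "\<And>n. m n > 0"
    and lim: "(\<lambda>n. ln (m n) / a n) \<longlonglongrightarrow> L" and q: "L < q"
  shows "\<forall>\<^sub>F n in sequentially. m n \<le> exp (a n * q)"
proof -
  have "\<forall>\<^sub>F n in sequentially. a n > 0"
    using a by (simp add: filterlim_at_top_dense)
  moreover have "\<forall>\<^sub>F n in sequentially. ln (m n) / a n < q"
    using lim q by (rule order_tendstoD)
  ultimately show ?thesis
  proof eventually_elim
    case (elim n)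
    then have "ln (m n) \<le> a n * q" by (simp add: field_simps)
    then have "exp (ln (m n)) \<le> exp (a n * q)" by simp
    then show ?case using m[of n] by simp
  qed
qed

lemma ln_ratio_tendsto_greater:
  fixes a m :: "nat \<Rightarrow> real"
  assumes a: "filterlim a at_top sequentially" and m: "\<And>n. m n > 0"
    and lim: "(\<lambda>n. ln (m n) / a n) \<longlonglongrightarrow> L" and q: "q < L"
  shows "\<forall>\<^sub>F n in sequentially. exp (a n * q) \<le> m n"
proof -
  have "\<forall>\<^sub>F n in sequentially. a n > 0"
    using a by (simp add: filterlim_at_top_dense)
  moreover have "\<forall>\<^sub>F n in sequentially. ln (m n) / a n > q"
    using lim q by (rule order_tendstoD)
  ultimately show ?thesis
  proof eventually_elim
    case (elim n)
    then have "a n * q \<le> ln (m n)" by (simp add: field_simps)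
    then have "exp (a n * q) \<le> exp (ln (m n))" by simp
    then show ?case using m[of n] by simp
  qed
qed

lemma (in prob_space) expectation_exp_pos:
  fixes Z :: "'a \<Rightarrow> real"
  assumes "integrable M (\<lambda>\<omega>. exp (Z \<omega>))"
  shows "expectation (\<lambda>\<omega>. exp (Z \<omega>)) > 0"
proof -
  have "expectation (\<lambda>\<omega>. exp (Z \<omega>)) \<noteq> 0"
  proof
    assume "expectation (\<lambda>\<omega>. exp (Z \<omega>)) = 0"
    then have "AE \<omega> in M. exp (Z \<omega>) = 0"
      using assms by (subst (asm) integral_nonneg_eq_0_iff_AE) auto
    then show False by simp
  qed
  moreover have "expectation (\<lambda>\<omega>. exp (Z \<omega>)) \<ge> 0" by (intro integral_nonneg_AE) auto
  ultimately show ?thesis by linarith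
qed

lemma (in prob_space) gaussian_mgf_upper_tail:
  fixes Y :: "nat \<Rightarrow> 'a \<Rightarrow> real" and a :: "nat \<Rightarrow> real" and s t c :: real
  assumes a: "filterlim a at_top sequentially"
    and int: "\<And>n l. integrable M (\<lambda>\<omega>. exp (l * a n * Y n \<omega>))"
    and lim: "\<And>l. (\<lambda>n. ln (expectation (\<lambda>\<omega>. exp (l * a n * Y n \<omega>))) / a n) \<longlonglongrightarrow> s * l\<^sup>2 / 2"
    and s: "s > 0" and t: "t > 0" and c: "c < t\<^sup>2 / (2 * s)"
  shows "\<forall>\<^sub>F n in sequentially. prob {\<omega> \<in> space M. Y n \<omega> \<ge> t} \<le> exp (- a n * c)"
proof -
  \<comment> \<open>This \<open>l\<close> maximises the Chernoff exponent
    \<open>l * t - s * l\<^sup>2 / 2\<close>, with maximum \<open>t\<^sup>2 / (2 * s)\<close>. As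
    \<open>c\<close> lies strictly below that maximum, \<open>q\<close> lies strictly above the
    limit of the log-Laplace transform, which leaves room for the eventual bound.\<close>
  define l where "l = t / s"
  define q where "q = l * t - c"
  have l: "l > 0" using s t by (simp add: l_def)
  have "s * l\<^sup>2 / 2 = l * t - t\<^sup>2 / (2 * s)"
    using s by (simp add: l_def field_simps power2_eq_square)
  then have "s * l\<^sup>2 / 2 < q" using c by (simp add: q_def)
  then have "\<forall>\<^sub>F n in sequentially. expectation (\<lambda>\<omega>. exp (l * a n * Y n \<omega>)) \<le> exp (a n * q)"
    by (intro ln_ratio_tendsto_less[OF a _ lim] expectation_exp_pos int)
  moreover have "\<forall>\<^sub>F n in sequentially. a n > 0"
    using a by (simp add: filterlim_at_top_dense)
  ultimately show ?thesis
  proof eventually_elim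
    case (elim n)
    have "prob {\<omega> \<in> space M. Y n \<omega> \<ge> t} \<le>
        exp (- (l * a n) * t) * expectation (\<lambda>\<omega>. exp (l * a n * Y n \<omega>))"
      using Chernoff_ineq_ge[of "l * a n" "space M" "Y n" t] int[of l n] l elim
      by (simp add: set_integrable_def set_lebesgue_integral_def cong: Bochner_Integration.integral_cong Bochner_Integration.integrable_cong)
    also have "\<dots> \<le> exp (- (l * a n) * t) * exp (a n * q)"
      using elim by (intro mult_left_mono) auto
    also have "\<dots> = exp (- a n * c)"
      by (simp add: q_def algebra_simps flip: exp_add)
    finally show ?case .
  qed
qed

text \<open>Tilting by \<open>exp (\<theta> * a n * Y n)\<close> with \<open>\<theta> = (t + e) / s\<close> concentrates the mass on \<open>t < Y n < t + 2 * e\<close>: the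
  contribution of the complement is bounded by Laplace transforms at \<open>\<theta> + \<mu>\<close> and \<open>\<theta> - \<mu>\<close>.\<close>

lemma (in prob_space) gaussian_mgf_lower_tail:
  fixes Y :: "nat \<Rightarrow> 'a \<Rightarrow> real" and a :: "nat \<Rightarrow> real" and s t c :: real
  assumes a: "filterlim a at_top sequentially"
    and int: "\<And>n l. integrable M (\<lambda>\<omega>. exp (l * a n * Y n \<omega>))"
    and Y[measurable]: "\<And>n. Y n \<in> borel_measurable M"
    and lim: "\<And>l. (\<lambda>n. ln (expectation (\<lambda>\<omega>. exp (l * a n * Y n \<omega>))) / a n) \<longlonglongrightarrow> s * l\<^sup>2 / 2"
    and s: "s > 0" and t: "t > 0" and c: "c > t\<^sup>2 / (2 * s)"
  shows "\<forall>\<^sub>F n in sequentially. exp (- a n * c) \<le> prob {\<omega> \<in> space M. Y n \<omega> > t}"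
proof -
  \<comment> \<open>\<open>g e\<close> is the rate that tilting achieves with a window of half-width
    \<open>e\<close>. It is continuous at 0 with value \<open>t\<^sup>2 / (2 * s)\<close>, so some
    positive \<open>e\<close> keeps it below \<open>c\<close>.\<close>
  define g where "g e = (t + e) * (t + 2 * e) / s + e\<^sup>2 / (4 * s) - (t + e)\<^sup>2 / (2 * s)" for e
  have "(g \<longlongrightarrow> g 0) (at_right 0)"
    unfolding g_def by (intro tendsto_intros) (use s in auto)
  moreover have "g 0 = t\<^sup>2 / (2 * s)"
    using s by (simp add: g_def field_simps power2_eq_square)
  ultimately have "\<forall>\<^sub>F e in at_right 0. g e < c"
    using c by (intro order_tendstoD) auto
  moreover have "\<forall>\<^sub>F e in at_right (0::real). e > 0"
    by (simp add: eventually_at_right_less)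
  ultimately obtain e where ge: "g e < c" and e: "e > 0"
    using eventually_happens[OF eventually_conj] by fastforce
  \<comment> \<open>Under the tilt the Gaussian mean is \<open>s * \<theta> = t + e\<close>, the
    centre of the window. \<open>\<mu>\<close> minimises
    \<open>s * \<mu>\<^sup>2 / 2 - e * \<mu>\<close>, and the minimum is
    \<open>- 4 * \<eta>\<close>. Of this gain one \<open>\<eta>\<close> pays for the upper estimate
    of each tail and one for the lower estimate of \<open>m n \<theta>\<close>, so
    \<open>2 * \<eta>\<close> remain.\<close>
  define \<theta> \<mu> \<eta> where "\<theta> = (t + e) / s" and "\<mu> = e / s" and "\<eta> = e\<^sup>2 / (8 * s)"
  have pos: "\<theta> > 0" "\<mu> > 0" "\<eta> > 0" using s t e by (auto simp: \<theta>_def \<mu>_def \<eta>_def)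
  define m where "m n l = expectation (\<lambda>\<omega>. exp (l * a n * Y n \<omega>))" for n l
  have m_pos: "m n l > 0" for n l
    unfolding m_def by (intro expectation_exp_pos int)
  have eq1: "s * (\<theta> + \<mu>)\<^sup>2 / 2 - \<mu> * (t + 2 * e) = s * \<theta>\<^sup>2 / 2 - 4 * \<eta>"
    and eq2: "s * (\<theta> - \<mu>)\<^sup>2 / 2 + \<mu> * t = s * \<theta>\<^sup>2 / 2 - 4 * \<eta>"
    using s by (auto simp: \<theta>_def \<mu>_def \<eta>_def field_simps power2_eq_square)
  have eq3: "s * \<theta>\<^sup>2 / 2 - 2 * \<eta> - \<theta> * (t + 2 * e) = - g e"
    using s by (simp add: \<theta>_def \<eta>_def g_def field_simps power2_eq_square)
  have E1: "\<forall>\<^sub>F n in sequentially. exp (a n * (s * \<theta>\<^sup>2 / 2 - \<eta>)) \<le> m n \<theta>"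
    using pos unfolding m_def by (intro ln_ratio_tendsto_greater[OF a _ lim] expectation_exp_pos int) auto
  have E2: "\<forall>\<^sub>F n in sequentially. m n (\<theta> + \<mu>) \<le> exp (a n * (s * (\<theta> + \<mu>)\<^sup>2 / 2 + \<eta>))"
    using pos unfolding m_def by (intro ln_ratio_tendsto_less[OF a _ lim] expectation_exp_pos int) auto
  have E3: "\<forall>\<^sub>F n in sequentially. m n (\<theta> - \<mu>) \<le> exp (a n * (s * (\<theta> - \<mu>)\<^sup>2 / 2 + \<eta>))"
    using pos unfolding m_def by (intro ln_ratio_tendsto_less[OF a _ lim] expectation_exp_pos int) auto
  have E4: "\<forall>\<^sub>F n in sequentially. a n > 1 / \<eta>"
    using a by (simp add: filterlim_at_top_dense)
  from E1 E2 E3 E4 show ?thesis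
  proof eventually_elim
    case (elim n)
    let ?A = "{\<omega> \<in> space M. Y n \<omega> > t}"
    have an: "a n > 0" using elim(4) pos by (smt (verit) zero_less_divide_1_iff)
    have a\<eta>: "a n * \<eta> > 1" using elim(4) pos by (simp add: field_simps)
    \<comment> \<open>An exponential Markov bound on either side of the window: below
      \<open>t\<close>, respectively above \<open>t + 2 * e\<close>, the extra factor in the third,
      respectively second, summand is at least 1.\<close>
    have pw: "exp (\<theta> * a n * Y n \<omega>) \<le> exp (\<theta> * a n * (t + 2 * e)) * indicator ?A \<omega>
        + exp ((\<theta> + \<mu>) * a n * Y n \<omega>) * exp (- (\<mu> * a n * (t + 2 * e)))
        + exp ((\<theta> - \<mu>) * a n * Y n \<omega>) * exp (\<mu> * a n * t)" if \<omega>: "\<omega> \<in> space M" for \<omega>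
    proof -
      let ?r2 = "exp ((\<theta> + \<mu>) * a n * Y n \<omega>) * exp (- (\<mu> * a n * (t + 2 * e)))"
      let ?r3 = "exp ((\<theta> - \<mu>) * a n * Y n \<omega>) * exp (\<mu> * a n * t)"
      have r2: "?r2 = exp (\<theta> * a n * Y n \<omega> + \<mu> * a n * (Y n \<omega> - (t + 2 * e)))"
        and r3: "?r3 = exp (\<theta> * a n * Y n \<omega> + \<mu> * a n * (t - Y n \<omega>))"
        by (simp_all add: algebra_simps flip: exp_add)
      have nn: "?r2 \<ge> 0" "?r3 \<ge> 0" "exp (\<theta> * a n * (t + 2 * e)) * indicator ?A \<omega> \<ge> 0" by auto
      consider "Y n \<omega> \<le> t" | "Y n \<omega> \<ge> t + 2 * e" | "t < Y n \<omega>" "Y n \<omega> \<le> t + 2 * e" by linarith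
      then show ?thesis
      proof cases
        case 1
        then have "exp (\<theta> * a n * Y n \<omega>) \<le> ?r3" unfolding r3 using pos an by simp
        then show ?thesis using nn by linarith
      next
        case 2
        then have "exp (\<theta> * a n * Y n \<omega>) \<le> ?r2" unfolding r2 using pos an by simp
        then show ?thesis using nn by linarith
      next
        case 3
        then have "exp (\<theta> * a n * Y n \<omega>) \<le> exp (\<theta> * a n * (t + 2 * e)) * indicator ?A \<omega>"
          using pos an \<omega> by simp
        then show ?thesis using nn by linarith
      qed
    qed
    have "m n \<theta> \<le> expectation (\<lambda>\<omega>. exp (\<theta> * a n * (t + 2 * e)) * indicator ?A \<omega>
        + exp ((\<theta> + \<mu>) * a n * Y n \<omega>) * exp (- (\<mu> * a n * (t + 2 * e)))
        + exp ((\<theta> - \<mu>) * a n * Y n \<omega>) * exp (\<mu> * a n * t))"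
      unfolding m_def using int
      by (intro integral_mono pw Bochner_Integration.integrable_add integrable_mult_left
        integrable_mult_right integrable_real_indicator) (auto simp: emeasure_eq_measure)
    also have "\<dots> = exp (\<theta> * a n * (t + 2 * e)) * prob ?A
        + m n (\<theta> + \<mu>) * exp (- (\<mu> * a n * (t + 2 * e))) + m n (\<theta> - \<mu>) * exp (\<mu> * a n * t)"
      unfolding m_def using int
      by (subst Bochner_Integration.integral_add Bochner_Integration.integrable_add integrable_mult_left
        integrable_mult_right integrable_real_indicator; (simp add: emeasure_eq_measure)?)+
    also have "m n (\<theta> + \<mu>) * exp (- (\<mu> * a n * (t + 2 * e))) \<le>
        exp (a n * (s * (\<theta> + \<mu>)\<^sup>2 / 2 + \<eta>)) * exp (- (\<mu> * a n * (t + 2 * e)))"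
      using elim by (intro mult_right_mono) auto
    also have "\<dots> = exp (a n * ((s * (\<theta> + \<mu>)\<^sup>2 / 2 - \<mu> * (t + 2 * e)) + \<eta>))"
      by (simp add: algebra_simps flip: exp_add)
    also have "\<dots> = exp (a n * (s * \<theta>\<^sup>2 / 2 - \<eta>)) * exp (- 2 * (a n * \<eta>))"
      unfolding eq1 by (simp add: algebra_simps flip: exp_add)
    also have "m n (\<theta> - \<mu>) * exp (\<mu> * a n * t) \<le>
        exp (a n * (s * (\<theta> - \<mu>)\<^sup>2 / 2 + \<eta>)) * exp (\<mu> * a n * t)"
      using elim by (intro mult_right_mono) auto
    also have "\<dots> = exp (a n * ((s * (\<theta> - \<mu>)\<^sup>2 / 2 + \<mu> * t) + \<eta>))"
      by (simp add: algebra_simps flip: exp_add)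
    also have "\<dots> = exp (a n * (s * \<theta>\<^sup>2 / 2 - \<eta>)) * exp (- 2 * (a n * \<eta>))"
      unfolding eq2 by (simp add: algebra_simps flip: exp_add)
    finally have A: "exp (a n * (s * \<theta>\<^sup>2 / 2 - \<eta>)) * (1 - 2 * exp (- 2 * (a n * \<eta>)))
        \<le> exp (\<theta> * a n * (t + 2 * e)) * prob ?A"
      using elim(1) by (simp add: algebra_simps)
    \<comment> \<open>Since \<open>a n * \<eta> > 1\<close>, \<open>y \<le> 1 / 2\<close> and hence
      \<open>1 - 2 * y\<^sup>2 \<ge> y\<close>: discarding both tails costs only one more factor
      \<open>exp (- (a n * \<eta>))\<close>.\<close>
    define y where "y = exp (- (a n * \<eta>))"
    have "exp (a n * \<eta>) \<ge> 1 + a n * \<eta>" by (rule exp_ge_add_one_self)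
    then have "exp (a n * \<eta>) \<ge> 2" using a\<eta> by linarith
    then have y: "y \<le> 1 / 2" "y > 0" unfolding y_def by (auto simp: exp_minus field_simps)
    have "exp (- 2 * (a n * \<eta>)) = y\<^sup>2"
      by (simp add: y_def power2_eq_square flip: exp_add)
    moreover have "y\<^sup>2 \<le> y * (1/2)" using y by (simp add: power2_eq_square)
    ultimately have "y \<le> 1 - 2 * exp (- 2 * (a n * \<eta>))" using y by simp
    then have "exp (a n * (s * \<theta>\<^sup>2 / 2 - \<eta>)) * y \<le> exp (\<theta> * a n * (t + 2 * e)) * prob ?A"
      using A by (meson exp_ge_zero mult_left_mono order_trans)
    then have "exp (- (\<theta> * a n * (t + 2 * e))) * (exp (a n * (s * \<theta>\<^sup>2 / 2 - \<eta>)) * y) \<le>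
        exp (- (\<theta> * a n * (t + 2 * e))) * (exp (\<theta> * a n * (t + 2 * e)) * prob ?A)"
      by (intro mult_left_mono) auto
    also have "\<dots> = prob ?A" by (simp add: exp_minus)
    also have "exp (- (\<theta> * a n * (t + 2 * e))) * (exp (a n * (s * \<theta>\<^sup>2 / 2 - \<eta>)) * y) =
        exp (a n * (s * \<theta>\<^sup>2 / 2 - 2 * \<eta> - \<theta> * (t + 2 * e)))"
      unfolding y_def by (simp add: algebra_simps flip: exp_add)
    finally have "exp (a n * - g e) \<le> prob ?A" unfolding eq3 .
    moreover have "exp (- a n * c) \<le> exp (a n * - g e)" using an ge by simp
    ultimately show ?case by linarith
  qed
qed

section \<open>Kernel sums: smoothing integrals and Laplace transforms\<close>

text \<open>In the cubic Lagrange remainder two of the three factors \<open>k\<close> are bounded by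
  \<open>b\<close> and one is kept. With \<open>k = K z\<close> the error is then dominated by a
  multiple of the integrable function \<open>K\<close>.\<close>

lemma exp_Taylor2_bound:
  fixes u k b :: real
  assumes u: "\<bar>u\<bar> \<le> 1" and k: "0 \<le> k" "k \<le> b"
  shows "\<bar>exp (u * k) - 1 - u * k - u\<^sup>2 / 2 * k\<^sup>2\<bar> \<le> \<bar>u\<bar> ^ 3 * (exp b * b\<^sup>2) * k"
proof -
  obtain t where t: "\<bar>t\<bar> \<le> \<bar>u * k\<bar>"
    and eq: "exp (u * k) = (\<Sum>m<3. (u * k) ^ m / fact m) + (exp t / fact 3) * (u * k) ^ 3"
    using Maclaurin_exp_le[of "u * k" 3] by blast
  have "\<bar>u * k\<bar> \<le> 1 * b" unfolding abs_mult using u k by (intro mult_mono) auto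
  then have tb: "exp t \<le> exp b" using t by simp
  have "exp (u * k) - 1 - u * k - u\<^sup>2 / 2 * k\<^sup>2 = (exp t / 6) * (u * k) ^ 3"
    unfolding eq by (simp add: numeral_3_eq_3 power2_eq_square fact_numeral)
  then have "\<bar>exp (u * k) - 1 - u * k - u\<^sup>2 / 2 * k\<^sup>2\<bar> = (exp t / 6) * (\<bar>u\<bar> ^ 3 * (k\<^sup>2 * k))"
    using k by (simp only: abs_mult power_abs[symmetric]) (simp add: abs_mult power3_eq_cube power2_eq_square)
  also have "exp t / 6 \<le> exp b" using tb exp_gt_zero[of b] by linarith
  then have "(exp t / 6) * (\<bar>u\<bar> ^ 3 * (k\<^sup>2 * k)) \<le> exp b * (\<bar>u\<bar> ^ 3 * (b\<^sup>2 * k))"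
    using k by (intro mult_mono power_mono order_refl) auto
  finally show ?thesis by (simp add: mult_ac)
qed

text \<open>Continuity of \<open>f\<close> at \<open>x\<close> suffices for the limits of the
  integrals below; second-order regularity is brought in separately, through the bias
  estimate.\<close>

locale kernel_sample = prob_space M for M :: "'w measure" +
  fixes X :: "nat \<Rightarrow> 'w \<Rightarrow> real ^ 'd" and f K :: "real ^ 'd \<Rightarrow> real" and x :: "real ^ 'd"
    and F B :: real
  assumes indep: "indep_vars (\<lambda>_. borel) X {1..}"
    and dens: "\<And>j. j \<ge> 1 \<Longrightarrow> distributed M lborel (X j) (\<lambda>y. ennreal (f y))"
    and f_nonneg: "\<And>y. 0 \<le> f y" and f_le: "\<And>y. f y \<le> F"
    and K_nonneg: "\<And>z. 0 \<le> K z" and K_le: "\<And>z. K z \<le> B"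
    and K_integrable: "integrable lborel K" and K_integral: "(LINT z|lborel. K z) = 1"
    and f_cont: "isCont f x"
begin

text \<open>For \<open>g = K\<close> and \<open>c > 0\<close> this is the mean of the kernel
  estimator with bandwidth \<open>c\<close>. It is written after the substitution
  \<open>y = x - c *\<^sub>R z\<close>, so that \<open>c\<close> occurs only inside \<open>f\<close>
  and one majorant serves all \<open>c\<close>.\<close>

definition smooth :: "(real ^ 'd \<Rightarrow> real) \<Rightarrow> real \<Rightarrow> real"
  where "smooth g c = (LINT z|lborel. g z * f (x - c *\<^sub>R z))"

text \<open>For \<open>c > 0\<close>, the excess over 1 of the Laplace transform of a single kernel
  term, divided by \<open>c ^ CARD('d)\<close>. Subtracting 1 makes the integrand integrable over
  the whole space.\<close>

definition exc :: "real \<Rightarrow> real \<Rightarrow> real"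
  where "exc u = smooth (\<lambda>z. exp (u * K z) - 1)"

definition mgf :: "nat \<Rightarrow> real \<Rightarrow> real \<Rightarrow> real"
  where "mgf n c u = expectation (\<lambda>\<omega>. exp (u * (\<Sum>j = 1..n. K ((x - X j \<omega>) /\<^sub>R c))))"

lemma B_nonneg: "0 \<le> B"
  using K_nonneg K_le order_trans by blast

lemma F_nonneg: "0 \<le> F"
  using f_nonneg f_le order_trans by blast

lemma f_measurable [measurable]: "f \<in> borel_measurable borel"
  using distributed_real_measurable[OF _ dens[of 1]] f_nonneg by simp

lemma K_measurable [measurable]: "K \<in> borel_measurable borel"
  using borel_measurable_integrable[OF K_integrable] by simp

lemma sum_K_measurable [measurable]:
  "(\<lambda>\<omega>. \<Sum>j = 1..n. K ((x - X j \<omega>) /\<^sub>R c)) \<in> borel_measurable M"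
proof (rule borel_measurable_sum)
  fix j assume "j \<in> {1..n}"
  then have [measurable]: "X j \<in> borel_measurable M"
    using distributed_measurable[OF dens[of j]] by simp
  show "(\<lambda>\<omega>. K ((x - X j \<omega>) /\<^sub>R c)) \<in> borel_measurable M" by measurable
qed

lemma K_sq_integrable: "integrable lborel (\<lambda>z. (K z)\<^sup>2)"
proof (rule Bochner_Integration.integrable_bound)
  show "integrable lborel (\<lambda>z. B * K z)" using K_integrable by simp
  show "AE z in lborel. norm ((K z)\<^sup>2) \<le> norm (B * K z)"
    using K_nonneg K_le B_nonneg by (intro AE_I2) (simp add: power2_eq_square abs_mult mult_right_mono)
qed simp

lemma smooth_integrable:
  assumes "integrable lborel g"
  shows "integrable lborel (\<lambda>z. g z * f (x - c *\<^sub>R z))"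
proof (rule Bochner_Integration.integrable_bound)
  show "integrable lborel (\<lambda>z. F * g z)" using assms by simp
  have [measurable]: "g \<in> borel_measurable borel"
    using borel_measurable_integrable[OF assms] by simp
  show "(\<lambda>z. g z * f (x - c *\<^sub>R z)) \<in> borel_measurable lborel" by measurable
  show "AE z in lborel. norm (g z * f (x - c *\<^sub>R z)) \<le> norm (F * g z)"
    using f_nonneg f_le F_nonneg
    by (intro AE_I2) (simp add: abs_mult mult.commute[of F] mult_left_mono)
qed

lemma abs_smooth_le:
  assumes "integrable lborel g" "integrable lborel w" "\<And>z. \<bar>g z\<bar> \<le> w z"
  shows "\<bar>smooth g c\<bar> \<le> F * (LINT z|lborel. w z)"
proof -
  have "\<bar>smooth g c\<bar> \<le> (LINT z|lborel. \<bar>g z * f (x - c *\<^sub>R z)\<bar>)"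
    unfolding smooth_def by (rule integral_abs_bound)
  also have "\<dots> \<le> (LINT z|lborel. F * w z)"
  proof (rule integral_mono)
    show "integrable lborel (\<lambda>z. \<bar>g z * f (x - c *\<^sub>R z)\<bar>)"
      using smooth_integrable[OF assms(1)] by simp
    show "integrable lborel (\<lambda>z. F * w z)" using assms by simp
    fix z
    have "\<bar>g z\<bar> * f (x - c *\<^sub>R z) \<le> w z * F"
      using assms(3)[of z] f_nonneg f_le by (intro mult_mono) auto
    then show "\<bar>g z * f (x - c *\<^sub>R z)\<bar> \<le> F * w z"
      using f_nonneg by (simp add: abs_mult mult.commute)
  qed
  finally show ?thesis by simp
qed

lemma smooth_tendsto:
  assumes g: "integrable lborel g" and c: "c \<longlonglongrightarrow> 0"
  shows "(\<lambda>n. smooth g (c n)) \<longlonglongrightarrow> (LINT z|lborel. g z) * f x"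
proof -
  have [measurable]: "g \<in> borel_measurable borel"
    using borel_measurable_integrable[OF g] by simp
  have "(\<lambda>n. LINT z|lborel. g z * f (x - c n *\<^sub>R z)) \<longlonglongrightarrow> (LINT z|lborel. g z * f x)"
  proof (rule integral_dominated_convergence)
    show "integrable lborel (\<lambda>z. F * \<bar>g z\<bar>)" using g by simp
    show "AE z in lborel. norm (g z * f (x - c n *\<^sub>R z)) \<le> F * \<bar>g z\<bar>" for n
      using f_nonneg f_le by (intro AE_I2) (simp add: abs_mult mult.commute[of F] mult_left_mono)
    show "AE z in lborel. (\<lambda>n. g z * f (x - c n *\<^sub>R z)) \<longlonglongrightarrow> g z * f x"
    proof (intro AE_I2 tendsto_mult tendsto_const)
      fix z
      have "(\<lambda>n. x - c n *\<^sub>R z) \<longlonglongrightarrow> x - 0 *\<^sub>R z" by (intro tendsto_intros c)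
      then have "(\<lambda>n. x - c n *\<^sub>R z) \<longlonglongrightarrow> x" by simp
      then show "(\<lambda>n. f (x - c n *\<^sub>R z)) \<longlonglongrightarrow> f x" by (rule isCont_tendsto_compose[OF f_cont])
    qed
  qed simp_all
  then show ?thesis by (simp add: smooth_def)
qed

text \<open>The substitution \<open>y = x - c *\<^sub>R z\<close> has Jacobian
  \<open>c ^ CARD('d)\<close> in absolute value.\<close>

lemma
  assumes g: "integrable lborel g" and c: "c > 0" and j: "j \<ge> 1"
  shows integrable_kernel: "integrable M (\<lambda>\<omega>. g ((x - X j \<omega>) /\<^sub>R c))"
    and expectation_kernel: "expectation (\<lambda>\<omega>. g ((x - X j \<omega>) /\<^sub>R c)) = c ^ CARD('d) * smooth g c"
proof -
  have [measurable]: "g \<in> borel_measurable borel"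
    using borel_measurable_integrable[OF g] by simp
  let ?r = "\<lambda>y. f y * g ((x - y) /\<^sub>R c)"
  let ?D = "density (distr lborel borel (\<lambda>z. x + (-c) *\<^sub>R z)) (\<lambda>_. ennreal (c ^ CARD('d)))"
  \<comment> \<open>Lebesgue measure is expressed as its own affine image with a constant density,
    so that integrability and the value of the integral are transferred by the same
    identity.\<close>
  have D: "(lborel :: (real ^ 'd) measure) = ?D"
    using lborel_affine[of "-c" x] c by simp
  have s: "g z * f (x - c *\<^sub>R z) = ?r (x + (-c) *\<^sub>R z)" for z using c by simp
  have "integrable lborel (\<lambda>z. c ^ CARD('d) * ?r (x + (-c) *\<^sub>R z))"
    using smooth_integrable[OF g, of c] unfolding s by simp
  then have "integrable ?D ?r"
    using c by (subst integrable_density) (auto simp: integrable_distr_eq)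
  then have 1: "integrable lborel ?r" using D by simp
  have "(LINT y|lborel. ?r y) = (LINT y|?D. ?r y)" using D by simp
  also have "\<dots> = (LINT z|lborel. c ^ CARD('d) * ?r (x + (-c) *\<^sub>R z))"
    using c by (subst integral_density) (auto simp: integral_distr)
  also have "\<dots> = c ^ CARD('d) * smooth g c"
    unfolding smooth_def s by simp
  finally have 2: "(LINT y|lborel. ?r y) = c ^ CARD('d) * smooth g c" .
  have "(\<lambda>y. g ((x - y) /\<^sub>R c)) \<in> borel_measurable lborel" by measurable
  from 1 2 distributed_integrable[OF dens[OF j] this] distributed_integral[OF dens[OF j] this] f_nonneg
  show "integrable M (\<lambda>\<omega>. g ((x - X j \<omega>) /\<^sub>R c))"
    and "expectation (\<lambda>\<omega>. g ((x - X j \<omega>) /\<^sub>R c)) = c ^ CARD('d) * smooth g c" by simp_all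
qed

text \<open>By the mean value theorem \<open>exp (u * K z) - 1\<close> is at most a constant times
  \<open>K z\<close>, because \<open>K\<close> is bounded by \<open>B\<close>.\<close>

lemma exp_K_integrable: "integrable lborel (\<lambda>z. exp (u * K z) - 1)"
proof (rule Bochner_Integration.integrable_bound)
  show "integrable lborel (\<lambda>z. (exp (\<bar>u\<bar> * B) * \<bar>u\<bar>) * K z)" using K_integrable by simp
  show "AE z in lborel. norm (exp (u * K z) - 1) \<le> norm ((exp (\<bar>u\<bar> * B) * \<bar>u\<bar>) * K z)"
  proof (rule AE_I2)
    fix z
    obtain t where t: "\<bar>t\<bar> \<le> \<bar>u * K z\<bar>" and eq: "exp (u * K z) = 1 + exp t * (u * K z)"
      using Maclaurin_exp_le[of "u * K z" 1] by auto
    have "\<bar>u * K z\<bar> \<le> \<bar>u\<bar> * B" unfolding abs_mult using K_nonneg K_le by (intro mult_mono) auto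
    then have "exp t \<le> exp (\<bar>u\<bar> * B)" using t by simp
    then have "exp t * (\<bar>u\<bar> * K z) \<le> exp (\<bar>u\<bar> * B) * (\<bar>u\<bar> * K z)"
      using K_nonneg by (intro mult_right_mono) auto
    then show "norm (exp (u * K z) - 1) \<le> norm ((exp (\<bar>u\<bar> * B) * \<bar>u\<bar>) * K z)"
      using K_nonneg by (simp add: eq abs_mult mult.assoc)
  qed
qed simp

text \<open>Independence factorises the transform; each factor is the expectation of
  \<open>exp - 1\<close>, an integrable function of the rescaled observation, plus the constant 1
  put back.\<close>

lemma mgf_eq:
  assumes c: "c > 0"
  shows "mgf n c u = (1 + c ^ CARD('d) * exc u c) ^ n"
proof -
  have I: "integrable M (\<lambda>\<omega>. exp (u * K ((x - X j \<omega>) /\<^sub>R c)))" if "j \<in> {1..n}" for j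
    using Bochner_Integration.integrable_add[OF integrable_kernel[OF exp_K_integrable[of u] c, of j]
        integrable_const[of 1]] that by simp
  have E: "expectation (\<lambda>\<omega>. exp (u * K ((x - X j \<omega>) /\<^sub>R c))) = 1 + c ^ CARD('d) * exc u c"
    if "j \<in> {1..n}" for j
    using expectation_kernel[OF exp_K_integrable[of u] c, of j] that I[OF that]
    by (simp add: exc_def prob_space)
  have "mgf n c u = expectation (\<lambda>\<omega>. \<Prod>j = 1..n. exp (u * K ((x - X j \<omega>) /\<^sub>R c)))"
    unfolding mgf_def by (simp add: sum_distrib_left exp_sum)
  also have "\<dots> = (\<Prod>j = 1..n. expectation (\<lambda>\<omega>. exp (u * K ((x - X j \<omega>) /\<^sub>R c))))"
  proof (rule indep_vars_lebesgue_integral)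
    have "indep_vars (\<lambda>_. borel) X {1..n}" by (rule indep_vars_subset[OF indep]) auto
    then show "indep_vars (\<lambda>_. borel) (\<lambda>j \<omega>. exp (u * K ((x - X j \<omega>) /\<^sub>R c))) {1..n}"
      by (rule indep_vars_compose2[where Y = "\<lambda>_ y. exp (u * K ((x - y) /\<^sub>R c))"]) measurable
  qed (use I in auto)
  also have "\<dots> = (1 + c ^ CARD('d) * exc u c) ^ n" using E by simp
  finally show ?thesis .
qed

lemma sum_K_bounds:
  "0 \<le> (\<Sum>j = 1..n. K ((x - X j \<omega>) /\<^sub>R c))" "(\<Sum>j = 1..n. K ((x - X j \<omega>) /\<^sub>R c)) \<le> real n * B"
  using K_nonneg sum_bounded_above[of "{1..n}" "\<lambda>j. K ((x - X j \<omega>) /\<^sub>R c)" B] K_le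
  by (auto intro: sum_nonneg)

lemma integrable_exp_sum_K:
  "integrable M (\<lambda>\<omega>. exp (p * (\<Sum>j = 1..n. K ((x - X j \<omega>) /\<^sub>R c)) + q))"
proof (rule integrable_const_bound)
  show "AE \<omega> in M. norm (exp (p * (\<Sum>j = 1..n. K ((x - X j \<omega>) /\<^sub>R c)) + q)) \<le> exp (\<bar>p\<bar> * (real n * B) + q)"
  proof (rule AE_I2)
    fix \<omega>
    have "p * (\<Sum>j = 1..n. K ((x - X j \<omega>) /\<^sub>R c)) \<le> \<bar>p\<bar> * (real n * B)"
      using sum_K_bounds[where n = n and c = c and \<omega> = \<omega>] by (intro mult_mono) auto
    then show "norm (exp (p * (\<Sum>j = 1..n. K ((x - X j \<omega>) /\<^sub>R c)) + q)) \<le> exp (\<bar>p\<bar> * (real n * B) + q)"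
      by simp
  qed
qed measurable

text \<open>The cubic error constant that results from integrating \<open>exp_Taylor2_bound\<close>
  with \<open>b = B\<close> against a density bounded by \<open>F\<close>, the kernel having mass
  1.\<close>

definition rem_const :: real
  where "rem_const = F * (exp B * B\<^sup>2)"

lemma exc_expansion:
  assumes u: "\<bar>u\<bar> \<le> 1"
  shows "\<bar>exc u c - u * smooth K c - u\<^sup>2 / 2 * smooth (\<lambda>z. (K z)\<^sup>2) c\<bar> \<le> \<bar>u\<bar> ^ 3 * rem_const"
proof -
  let ?g = "\<lambda>z. exp (u * K z) - 1 - u * K z - u\<^sup>2 / 2 * (K z)\<^sup>2"
  have "exc u c - u * smooth K c - u\<^sup>2 / 2 * smooth (\<lambda>z. (K z)\<^sup>2) c = smooth ?g c"
    unfolding exc_def smooth_def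
    using smooth_integrable[OF exp_K_integrable[of u], of c] smooth_integrable[OF K_integrable, of c]
      smooth_integrable[OF K_sq_integrable, of c]
    by (simp add: left_diff_distrib mult.assoc)
  moreover have "\<bar>smooth ?g c\<bar> \<le> F * (LINT z|lborel. \<bar>u\<bar> ^ 3 * (exp B * B\<^sup>2) * K z)"
  proof (rule abs_smooth_le)
    show "integrable lborel ?g"
      using K_integrable K_sq_integrable by (auto intro!: Bochner_Integration.integrable_diff[OF Bochner_Integration.integrable_diff[OF exp_K_integrable]])
    show "\<bar>?g z\<bar> \<le> \<bar>u\<bar> ^ 3 * (exp B * B\<^sup>2) * K z" for z
      by (rule exp_Taylor2_bound[OF u K_nonneg K_le])
  qed (use K_integrable in simp)
  ultimately show ?thesis by (simp add: K_integral rem_const_def mult_ac)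
qed

lemma kappa_pos: "kappa K > 0"
proof -
  have "kappa K \<noteq> 0"
  proof
    assume "kappa K = 0"
    then have "AE z in lborel. (K z)\<^sup>2 = 0"
      unfolding kappa_def using K_sq_integrable by (subst (asm) integral_nonneg_eq_0_iff_AE) auto
    then have "(LINT z|lborel. K z) = 0" by (intro integral_eq_zero_AE) auto
    then show False using K_integral by simp
  qed
  moreover have "kappa K \<ge> 0" unfolding kappa_def by (intro integral_nonneg_AE) auto
  ultimately show ?thesis by linarith
qed

end

section \<open>Second-order Taylor remainder and the bias\<close>

text \<open>One argument is pinned at \<open>x\<close>, so this is weaker than a local Lipschitz
  property; it is what differentiability of the derivative provides for the mean value
  inequality.\<close>

lemma differentiable_imp_lipschitz_at:
  fixes f :: "'a::real_normed_vector \<Rightarrow> 'b::real_normed_vector"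
  assumes "f differentiable (at x)"
  obtains C r where "r > 0" "C \<ge> 0" "\<And>y. norm (y - x) < r \<Longrightarrow> norm (f y - f x) \<le> C * norm (y - x)"
proof -
  obtain T where "(f has_derivative T) (at x)" using assms by (auto simp: differentiable_def)
  then have T: "bounded_linear T"
    and "\<forall>e>0. \<exists>d>0. \<forall>y. norm (y - x) < d \<longrightarrow> norm (f y - f x - T (y - x)) \<le> e * norm (y - x)"
    by (auto simp: has_derivative_at_alt)
  then obtain r where r: "r > 0" "\<And>y. norm (y - x) < r \<Longrightarrow> norm (f y - f x - T (y - x)) \<le> 1 * norm (y - x)"
    using zero_less_one by blast
  have "norm (f y - f x) \<le> (1 + onorm T) * norm (y - x)" if "norm (y - x) < r" for y
  proof -
    have "norm (f y - f x) \<le> norm (f y - f x - T (y - x)) + norm (T (y - x))"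
      by (metis add.commute norm_triangle_sub)
    then show ?thesis using r(2)[OF that] onorm[OF T, of "y - x"] by (simp add: algebra_simps)
  qed
  moreover have "1 + onorm T \<ge> 0" using onorm_pos_le[OF T] by simp
  ultimately show ?thesis using that r(1) by blast
qed

text \<open>Near \<open>x\<close> the mean value inequality applies, with a derivative that deviates
  from its value at \<open>x\<close> at most linearly. Far from \<open>x\<close> the remainder grows
  at most linearly because \<open>f\<close> is bounded. A global bound is sought because the kernel
  may have unbounded support.\<close>

lemma twice_differentiable_quadratic_remainder:
  fixes f :: "'a::real_normed_vector \<Rightarrow> real"
  assumes f: "twice_differentiable_at f x" and bdd: "\<And>y. \<bar>f y\<bar> \<le> F"
  obtains D :: "'a \<Rightarrow>\<^sub>L real" and C where "\<And>y. \<bar>f y - f x - D (y - x)\<bar> \<le> C * (norm (y - x))\<^sup>2"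
proof -
  obtain f' :: "'a \<Rightarrow> 'a \<Rightarrow>\<^sub>L real"
    where ev: "\<forall>\<^sub>F y in nhds x. (f has_derivative blinfun_apply (f' y)) (at y)"
      and f': "f' differentiable (at x)"
    using f by (auto simp: twice_differentiable_at_def)
  obtain r1 where r1: "r1 > 0" "\<And>y. dist y x < r1 \<Longrightarrow> (f has_derivative blinfun_apply (f' y)) (at y)"
    using ev by (auto simp: eventually_nhds_metric)
  obtain C0 r2 where r2: "r2 > 0" "C0 \<ge> 0"
    "\<And>y. norm (y - x) < r2 \<Longrightarrow> norm (f' y - f' x) \<le> C0 * norm (y - x)"
    using differentiable_imp_lipschitz_at[OF f'] by blast
  define r where "r = min r1 r2"
  have r: "r > 0" using r1 r2 by (simp add: r_def)
  define L where "L = norm (f' x)"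
  have F: "F \<ge> 0" using bdd[of x] by linarith
  \<comment> \<open>\<open>C0\<close> serves the ball of radius \<open>r\<close>. Outside it,
    \<open>norm (y - x) \<ge> r\<close> lets the square absorb the constant \<open>2 * F\<close> and
    the linear term with slope \<open>L\<close>; this produces the other two summands.\<close>
  define C where "C = C0 + 2 * F / r\<^sup>2 + L / r"
  have pieces: "2 * F / r\<^sup>2 \<ge> 0" "L / r \<ge> 0" using F r by (auto simp: L_def)
  have "\<bar>f y - f x - f' x (y - x)\<bar> \<le> C * (norm (y - x))\<^sup>2" for y
  proof (cases "norm (y - x) < r")
    case True
    have "norm (f y - f x - f' x (y - x)) \<le> norm (y - x) * (C0 * norm (y - x))"
    proof (rule differentiable_bound_linearization[where S = "cball x (norm (y - x))"])
      fix t :: real assume "t \<in> {0..1}"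
      then show "x + t *\<^sub>R (y - x) \<in> cball x (norm (y - x))"
        by (simp add: dist_norm mult_left_le_one_le)
    next
      fix z assume "z \<in> cball x (norm (y - x))"
      then have z: "norm (z - x) \<le> norm (y - x)" by (simp add: dist_norm norm_minus_commute)
      then have "dist z x < r1" using True by (simp add: r_def dist_norm)
      then show "(f has_derivative blinfun_apply (f' z)) (at z within cball x (norm (y - x)))"
        using r1(2) has_derivative_at_withinI by blast
      have "onorm (blinfun_apply (f' z) - blinfun_apply (f' x)) = norm (f' z - f' x)"
        by (simp add: norm_blinfun.rep_eq minus_blinfun.rep_eq fun_diff_def)
      also have "\<dots> \<le> C0 * norm (z - x)" using z True by (intro r2) (simp add: r_def)
      also have "\<dots> \<le> C0 * norm (y - x)" using z r2 by (intro mult_left_mono)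
      finally show "onorm (blinfun_apply (f' z) - blinfun_apply (f' x)) \<le> C0 * norm (y - x)" .
    qed simp
    also have "\<dots> = C0 * (norm (y - x))\<^sup>2" by (simp add: power2_eq_square)
    also have "\<dots> \<le> C * (norm (y - x))\<^sup>2"
      using pieces by (intro mult_right_mono) (auto simp: C_def)
    finally show ?thesis by simp
  next
    case False
    define s where "s = norm (y - x)"
    have s: "s \<ge> r" using False by (simp add: s_def)
    have "\<bar>f' x (y - x)\<bar> \<le> L * s"
      using norm_blinfun[of "f' x" "y - x"] by (simp add: L_def s_def)
    then have "\<bar>f y - f x - f' x (y - x)\<bar> \<le> 2 * F + L * s"
      using bdd[of x] bdd[of y] by linarith
    also have "2 * F \<le> (2 * F / r\<^sup>2) * s\<^sup>2"
    proof -
      have "r\<^sup>2 \<le> s\<^sup>2" using s r by (intro power_mono) auto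
      then have "(2 * F / r\<^sup>2) * r\<^sup>2 \<le> (2 * F / r\<^sup>2) * s\<^sup>2" using pieces by (intro mult_left_mono)
      then show ?thesis using r by simp
    qed
    also have "L * s \<le> (L / r) * s\<^sup>2"
    proof -
      have "(L / r * s) * r \<le> (L / r * s) * s"
        using s r pieces by (intro mult_left_mono mult_nonneg_nonneg) auto
      then show ?thesis using r by (simp add: power2_eq_square)
    qed
    also have "2 * F / r\<^sup>2 * s\<^sup>2 + L / r * s\<^sup>2 \<le> C * s\<^sup>2"
      using r2 by (simp add: C_def algebra_simps)
    finally show ?thesis by (simp add: s_def)
  qed
  then show ?thesis by (rule that)
qed

context kernel_sample begin

text \<open>The linear Taylor term integrates to zero by the vanishing first moments, and the
  quadratic remainder integrates to the second moment times \<open>c\<^sup>2\<close>.\<close>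

lemma smooth_K_bias:
  assumes moment1: "\<And>j. (LINT z|lborel. z $ j * K z) = 0"
    and moment2: "integrable lborel (\<lambda>z. (norm z)\<^sup>2 * \<bar>K z\<bar>)"
    and f: "twice_differentiable_at f x"
  obtains C where "\<And>c. \<bar>smooth K c - f x\<bar> \<le> C * c\<^sup>2"
proof -
  have "\<bar>f y\<bar> \<le> F" for y using f_nonneg f_le by simp
  then obtain D :: "(real ^ 'd) \<Rightarrow>\<^sub>L real" and C
    where DC: "\<And>y. \<bar>f y - f x - D (y - x)\<bar> \<le> C * (norm (y - x))\<^sup>2"
    using twice_differentiable_quadratic_remainder[OF f] by blast
  have moment2': "integrable lborel (\<lambda>z. (norm z)\<^sup>2 * K z)" using moment2 K_nonneg by simp
  \<comment> \<open>Integrability has to be derived from the second moment: \<open>moment1\<close>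
    alone does not give it, since the integral of a nonintegrable function is 0 by default.\<close>
  have comp: "integrable lborel (\<lambda>z. z $ j * K z)" for j
  proof (rule Bochner_Integration.integrable_bound)
    show "integrable lborel (\<lambda>z. K z + (norm z)\<^sup>2 * K z)" using K_integrable moment2' by simp
    show "AE z in lborel. norm (z $ j * K z) \<le> norm (K z + (norm z)\<^sup>2 * K z)"
    proof (rule AE_I2)
      fix z :: "real ^ 'd"
      have "2 * norm z \<le> 1 + (norm z)\<^sup>2" using sum_squares_bound[of 1 "norm z"] by simp
      then have "norm z \<le> 1 + (norm z)\<^sup>2" using norm_ge_zero[of z] by linarith
      then have "\<bar>z $ j\<bar> \<le> 1 + (norm z)\<^sup>2" using component_le_norm_cart[of z j] by linarith
      then have "\<bar>z $ j\<bar> * K z \<le> (1 + (norm z)\<^sup>2) * K z" using K_nonneg by (intro mult_right_mono)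
      then show "norm (z $ j * K z) \<le> norm (K z + (norm z)\<^sup>2 * K z)"
        using K_nonneg by (simp add: abs_mult algebra_simps)
    qed
  qed measurable
  have Dz: "D z * K z = (\<Sum>j\<in>UNIV. D (axis j 1) * (z $ j * K z))" for z
  proof -
    have "D z = D (\<Sum>j\<in>UNIV. z $ j *\<^sub>R axis j 1)"
      using basis_expansion[of z] by (simp add: scalar_mult_eq_scaleR)
    then show ?thesis
      by (simp add: blinfun.sum_right blinfun.scaleR_right sum_distrib_left mult_ac)
  qed
  have D_int: "integrable lborel (\<lambda>z. D z * K z)" unfolding Dz using comp by simp
  have D_zero: "(LINT z|lborel. D z * K z) = 0" unfolding Dz using comp moment1 by simp
  have "\<bar>smooth K c - f x\<bar> \<le> (C * (LINT z|lborel. (norm z)\<^sup>2 * K z)) * c\<^sup>2" for c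
  proof -
    \<comment> \<open>The last summand has integral zero; it is inserted to complete the Taylor
      remainder at \<open>x - c *\<^sub>R z\<close>.\<close>
    let ?g = "\<lambda>z. K z * f (x - c *\<^sub>R z) - f x * K z + c * (D z * K z)"
    have g: "integrable lborel ?g"
      using smooth_integrable[OF K_integrable] K_integrable D_int by simp
    have "smooth K c - f x = (LINT z|lborel. ?g z)"
      unfolding smooth_def using smooth_integrable[OF K_integrable, of c] K_integrable D_int
      by (simp add: D_zero K_integral)
    also have "\<bar>\<dots>\<bar> \<le> (LINT z|lborel. \<bar>?g z\<bar>)" by (rule integral_abs_bound)
    also have "\<dots> \<le> (LINT z|lborel. (C * c\<^sup>2) * ((norm z)\<^sup>2 * K z))"
    proof (rule integral_mono)
      show "integrable lborel (\<lambda>z. \<bar>?g z\<bar>)" using g by simp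
      show "integrable lborel (\<lambda>z. C * c\<^sup>2 * ((norm z)\<^sup>2 * K z))" using moment2' by simp
      fix z
      have "?g z = K z * (f (x - c *\<^sub>R z) - f x - D ((x - c *\<^sub>R z) - x))"
        by (simp add: blinfun.minus_right blinfun.scaleR_right algebra_simps)
      then have "\<bar>?g z\<bar> = K z * \<bar>f (x - c *\<^sub>R z) - f x - D ((x - c *\<^sub>R z) - x)\<bar>"
        using K_nonneg by (simp add: abs_mult)
      also have "\<dots> \<le> K z * (C * (norm ((x - c *\<^sub>R z) - x))\<^sup>2)"
        using DC K_nonneg by (intro mult_left_mono)
      finally show "\<bar>?g z\<bar> \<le> C * c\<^sup>2 * ((norm z)\<^sup>2 * K z)"
        by (simp add: power_mult_distrib mult_ac)
    qed
    also have "\<dots> = (C * c\<^sup>2) * (LINT z|lborel. (norm z)\<^sup>2 * K z)"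
      by (rule integral_mult_right_zero)
    finally show ?thesis by (simp only: mult_ac)
  qed
  then show ?thesis by (rule that)
qed

section \<open>Tails and log-Laplace asymptotics of the kernel estimator\<close>

lemma kde_measurable [measurable]: "kde K h X n x \<in> borel_measurable M"
  unfolding kde_def[abs_def] by measurable

lemma integrable_exp_kde: "integrable M (\<lambda>\<omega>. exp (p * kde K h X n x \<omega> + q))"
  using integrable_exp_sum_K[where p = "p * (1 / (real n * h n ^ CARD('d)))" and n = n and c = "h n" and q = q]
  unfolding kde_def by (simp only: mult.assoc)

lemma expectation_exp_kde:
  assumes "n \<ge> 1" "h n > 0"
  shows "expectation (\<lambda>\<omega>. exp (p * (real n * h n ^ CARD('d)) * (kde K h X n x \<omega> - q))) =
    (1 + h n ^ CARD('d) * exc p (h n)) ^ n * exp (- (p * (real n * h n ^ CARD('d)) * q))"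
proof -
  have "exp (p * (real n * h n ^ CARD('d)) * (kde K h X n x \<omega> - q)) =
    exp (p * (\<Sum>j = 1..n. K ((x - X j \<omega>) /\<^sub>R h n))) * exp (- (p * (real n * h n ^ CARD('d)) * q))" for \<omega>
    using assms unfolding kde_def by (simp add: right_diff_distrib flip: exp_add)
  then show ?thesis using mgf_eq[OF assms(2), of n p] by (simp add: mgf_def)
qed

text \<open>Chernoff's bound with a fixed small parameter \<open>u\<close>: the gain
  \<open>u * e\<close> is linear in \<open>u\<close>, while the second- and third-order cost is at
  most \<open>u\<^sup>2 * C\<close>. The sign \<open>\<sigma>\<close> covers both tails at
  once.\<close>

lemma kde_tail:
  fixes h :: "nat \<Rightarrow> real"
  assumes h_pos: "\<And>n. n \<ge> 1 \<Longrightarrow> h n > 0" and h: "h \<longlonglongrightarrow> 0" and e: "e > 0"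
    and \<sigma>: "\<bar>\<sigma>\<bar> = (1::real)"
  shows "\<exists>\<eta>>0. \<forall>\<^sub>F n in sequentially.
    prob {\<omega> \<in> space M. \<sigma> * (kde K h X n x \<omega> - f x) \<ge> e} \<le> exp (- (real n * h n ^ CARD('d)) * \<eta>)"
proof -
  \<comment> \<open>For \<open>u \<le> 1\<close> the cubic term is at most
    \<open>u\<^sup>2 * rem_const\<close>, so \<open>C\<close> bounds both higher-order coefficients;
    the 1 ensures \<open>C > 0\<close>. The choice of \<open>u\<close> keeps the cost below
    \<open>u * e / 4\<close>. A bias below \<open>e / 4\<close> costs as much again, and half of the
    gain survives.\<close>
  define C where "C = F * kappa K / 2 + rem_const + 1"
  have rem: "rem_const \<ge> 0" using F_nonneg by (simp add: rem_const_def)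
  have C: "C > 0" using rem F_nonneg kappa_pos unfolding C_def
    by (intro add_nonneg_pos add_nonneg_nonneg divide_nonneg_pos mult_nonneg_nonneg) auto
  define u where "u = min 1 (e / (4 * C))"
  have u: "0 < u" "u \<le> 1" "u * C \<le> e / 4"
  proof -
    show "0 < u" "u \<le> 1" using C e by (auto simp: u_def)
    have "u * C \<le> e / (4 * C) * C" using C by (intro mult_right_mono) (auto simp: u_def)
    then show "u * C \<le> e / 4" using C by simp
  qed
  have au: "\<bar>\<sigma> * u\<bar> = u" "(\<sigma> * u)\<^sup>2 = u\<^sup>2"
    using \<sigma> u by (auto simp: abs_mult power_mult_distrib simp flip: power2_abs[of \<sigma>])
  have "(\<lambda>n. smooth K (h n)) \<longlonglongrightarrow> f x" using smooth_tendsto[OF K_integrable h] K_integral by simp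
  then have "\<forall>\<^sub>F n in sequentially. \<bar>smooth K (h n) - f x\<bar> < e / 4"
    using e unfolding tendsto_iff dist_real_def by (metis divide_pos_pos zero_less_numeral)
  then have "\<forall>\<^sub>F n in sequentially. prob {\<omega> \<in> space M. \<sigma> * (kde K h X n x \<omega> - f x) \<ge> e}
      \<le> exp (- (real n * h n ^ CARD('d)) * (u * e / 2))"
    using eventually_ge_at_top[of "1::nat"]
  proof eventually_elim
    case (elim n)
    let ?b = "real n * h n ^ CARD('d)"
    have hn: "h n > 0" using h_pos elim by simp
    have b: "?b > 0" using hn elim by simp
    have m2: "smooth (\<lambda>z. (K z)\<^sup>2) (h n) \<le> F * kappa K"
      using abs_smooth_le[OF K_sq_integrable K_sq_integrable, of "h n"] by (simp add: kappa_def)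
    have "exc (\<sigma> * u) (h n) \<le> \<sigma> * u * smooth K (h n) + u\<^sup>2 / 2 * smooth (\<lambda>z. (K z)\<^sup>2) (h n) + u ^ 3 * rem_const"
      using exc_expansion[of "\<sigma> * u" "h n"] u unfolding au by linarith
    also have "\<dots> \<le> \<sigma> * u * smooth K (h n) + u\<^sup>2 / 2 * (F * kappa K) + u\<^sup>2 * rem_const"
      using m2 u rem by (intro add_mono mult_left_mono mult_right_mono order_refl power_decreasing) auto
    also have "\<dots> \<le> \<sigma> * u * smooth K (h n) + u * (u * C)"
      by (simp add: C_def algebra_simps power2_eq_square)
    also have "\<dots> \<le> \<sigma> * u * smooth K (h n) + u * (e / 4)"
      using u by simp
    finally have "exc (\<sigma> * u) (h n) - \<sigma> * u * f x \<le> u * (\<sigma> * (smooth K (h n) - f x)) + u * (e / 4)"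
      by (simp add: algebra_simps)
    also have "\<sigma> * (smooth K (h n) - f x) \<le> \<bar>\<sigma> * (smooth K (h n) - f x)\<bar>" by simp
    also have "\<dots> \<le> e / 4" using elim \<sigma> by (simp add: abs_mult)
    finally have key: "exc (\<sigma> * u) (h n) - \<sigma> * u * f x \<le> u * e / 2"
      using u by (simp add: mult_left_mono mult.commute)
    have int: "integrable M (\<lambda>\<omega>. exp ((u * ?b) * (\<sigma> * (kde K h X n x \<omega> - f x))))"
      using integrable_exp_kde[where p = "u * ?b * \<sigma>" and h = h and n = n and q = "- (u * ?b * \<sigma> * f x)"] by (simp add: algebra_simps)
    have "prob {\<omega> \<in> space M. \<sigma> * (kde K h X n x \<omega> - f x) \<ge> e} \<le>
        exp (- (u * ?b) * e) * expectation (\<lambda>\<omega>. exp ((u * ?b) * (\<sigma> * (kde K h X n x \<omega> - f x))))"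
      using Chernoff_ineq_ge[of "u * ?b" "space M" "\<lambda>\<omega>. \<sigma> * (kde K h X n x \<omega> - f x)" e] int u b
      by (simp add: set_integrable_def set_lebesgue_integral_def cong: Bochner_Integration.integral_cong Bochner_Integration.integrable_cong)
    also have "(\<lambda>\<omega>. exp ((u * ?b) * (\<sigma> * (kde K h X n x \<omega> - f x)))) =
        (\<lambda>\<omega>. exp ((\<sigma> * u) * ?b * (kde K h X n x \<omega> - f x)))"
      by (simp add: mult_ac)
    also have "expectation \<dots> =
        (1 + h n ^ CARD('d) * exc (\<sigma> * u) (h n)) ^ n * exp (- ((\<sigma> * u) * ?b * f x))"
      using elim hn by (intro expectation_exp_kde) auto
    also have "(1 + h n ^ CARD('d) * exc (\<sigma> * u) (h n)) ^ n \<le> exp (h n ^ CARD('d) * exc (\<sigma> * u) (h n)) ^ n"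
    proof (rule power_mono)
      \<comment> \<open>The base of the power is the Laplace transform of a single term, hence
        nonnegative, as monotonicity of the power demands.\<close>
      have "mgf 1 (h n) (\<sigma> * u) \<ge> 0" unfolding mgf_def by (intro integral_nonneg_AE) auto
      then show "0 \<le> 1 + h n ^ CARD('d) * exc (\<sigma> * u) (h n)" using mgf_eq[OF hn, of 1] by simp
    qed (rule exp_ge_add_one_self)
    also have "\<dots> = exp (?b * exc (\<sigma> * u) (h n))"
      by (simp add: mult_ac flip: exp_of_nat_mult)
    finally have "prob {\<omega> \<in> space M. \<sigma> * (kde K h X n x \<omega> - f x) \<ge> e} \<le>
       exp (- (u * ?b) * e) * (exp (?b * exc (\<sigma> * u) (h n)) * exp (- ((\<sigma> * u) * ?b * f x)))"
      by simp
    also have "\<dots> = exp (?b * ((exc (\<sigma> * u) (h n) - \<sigma> * u * f x) - u * e))"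
      by (simp add: algebra_simps flip: exp_add)
    also have "\<dots> \<le> exp (?b * (u * e / 2 - u * e))"
      unfolding exp_le_cancel_iff using key b by (intro mult_left_mono diff_right_mono) auto
    also have "\<dots> = exp (- ?b * (u * e / 2))" by (simp add: algebra_simps)
    finally show ?case .
  qed
  moreover have "u * e / 2 > 0" using u e by simp
  ultimately show ?thesis by blast
qed

text \<open>The kernel sum is tilted by \<open>l / v n\<close>, which tends to 0, so the expansion
  of \<open>exc\<close> applies. After normalisation its linear term, less the centring, is
  \<open>l\<close> times the scaled bias. The quadratic term gives the Gaussian limit, and the cubic
  remainder is \<open>O(1 / v n)\<close>.\<close>

lemma kde_log_mgf_tendsto:
  fixes h v :: "nat \<Rightarrow> real"
  assumes h_pos: "\<And>n. n \<ge> 1 \<Longrightarrow> h n > 0" and h: "h \<longlonglongrightarrow> 0"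
    and v_pos: "\<And>n. n \<ge> 1 \<Longrightarrow> v n > 0" and v: "filterlim v at_top sequentially"
    and bias: "(\<lambda>n. v n * (smooth K (h n) - f x)) \<longlonglongrightarrow> 0"
  shows "(\<lambda>n. ln (expectation (\<lambda>\<omega>. exp (l * (real n * h n ^ CARD('d) / (v n)\<^sup>2) * (v n * (kde K h X n x \<omega> - f x)))))
      / (real n * h n ^ CARD('d) / (v n)\<^sup>2)) \<longlonglongrightarrow> (kappa K * f x) * l\<^sup>2 / 2"
proof -
  let ?d = "CARD('d)"
  define m1 m2 G r where "m1 n = smooth K (h n)" and "m2 n = smooth (\<lambda>z. (K z)\<^sup>2) (h n)"
    and "G n = exc (l / v n) (h n)"
    and "r n = (G n - l / v n * m1 n - (l / v n)\<^sup>2 / 2 * m2 n) * (v n)\<^sup>2" for n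
  have m1: "m1 \<longlonglongrightarrow> f x" and m2: "m2 \<longlonglongrightarrow> kappa K * f x"
    unfolding m1_def m2_def
    using smooth_tendsto[OF K_integrable h] smooth_tendsto[OF K_sq_integrable h] K_integral
    by (simp_all add: kappa_def)
  have inv: "(\<lambda>n. 1 / v n) \<longlonglongrightarrow> 0"
    using tendsto_divide_0[OF tendsto_const filterlim_at_top_imp_at_infinity[OF v]] .
  have lv: "(\<lambda>n. l / v n) \<longlonglongrightarrow> 0"
    using tendsto_divide_0[OF tendsto_const filterlim_at_top_imp_at_infinity[OF v]] .
  have small: "\<forall>\<^sub>F n in sequentially. \<bar>l / v n\<bar> < 1"
    using lv by (auto simp: tendsto_iff dist_real_def)
  have r: "r \<longlonglongrightarrow> 0"
  proof (rule tendsto_rabs_zero_cancel, rule tendsto_sandwich[OF _ _ tendsto_const])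
    show "\<forall>\<^sub>F n in sequentially. \<bar>r n\<bar> \<le> \<bar>l\<bar> ^ 3 * rem_const * (1 / v n)"
      using small eventually_ge_at_top[of 1]
    proof eventually_elim
      case (elim n)
      have vn: "v n > 0" using v_pos elim by simp
      have "\<bar>r n\<bar> \<le> (\<bar>l / v n\<bar> ^ 3 * rem_const) * (v n)\<^sup>2"
        unfolding r_def abs_mult G_def m1_def m2_def
        using elim by (simp only: abs_power2) (intro mult_right_mono exc_expansion, auto)
      also have "\<dots> = \<bar>l\<bar> ^ 3 * rem_const * (1 / v n)"
        using vn by (simp add: abs_mult field_simps power3_eq_cube power2_eq_square)
      finally show ?case .
    qed
    show "(\<lambda>n. \<bar>l\<bar> ^ 3 * rem_const * (1 / v n)) \<longlonglongrightarrow> 0"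
      using tendsto_mult[OF tendsto_const inv] by simp
  qed simp
  have G: "\<forall>\<^sub>F n in sequentially. v n * G n = l * m1 n + l\<^sup>2 / 2 * m2 n * (1 / v n) + r n * (1 / v n)"
    using eventually_ge_at_top[of 1]
  proof eventually_elim
    case (elim n)
    have "v n > 0" using v_pos elim by simp
    then show ?case by (simp add: r_def field_simps power2_eq_square)
  qed
  have vG: "(\<lambda>n. v n * G n) \<longlonglongrightarrow> l * f x"
  proof -
    have "(\<lambda>n. l * m1 n + l\<^sup>2 / 2 * m2 n * (1 / v n) + r n * (1 / v n))
        \<longlonglongrightarrow> l * f x + l\<^sup>2 / 2 * (kappa K * f x) * 0 + 0 * 0"
      by (intro tendsto_intros m1 m2 r inv)
    then show ?thesis using tendsto_cong[OF G] by simp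
  qed
  have hd: "(\<lambda>n. h n ^ ?d) \<longlonglongrightarrow> 0"
    using tendsto_power[OF h, of ?d] by (simp add: power_0_left)
  define y where "y n = h n ^ ?d * G n" for n
  have "G \<longlonglongrightarrow> 0"
  proof -
    have "(\<lambda>n. (v n * G n) * (1 / v n)) \<longlonglongrightarrow> l * f x * 0" by (intro tendsto_mult vG inv)
    moreover have "\<forall>\<^sub>F n in sequentially. (v n * G n) * (1 / v n) = G n"
      using eventually_ge_at_top[of 1] by eventually_elim (use v_pos in force)
    ultimately show ?thesis using tendsto_cong by fastforce
  qed
  then have y: "y \<longlonglongrightarrow> 0" unfolding y_def using tendsto_mult[OF hd] by fastforce
  have ysmall: "\<forall>\<^sub>F n in sequentially. \<bar>y n\<bar> < 1 / 2"
    using y by (auto simp: tendsto_iff dist_real_def dest: spec[of _ "1/2"])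
  \<comment> \<open>The error of replacing \<open>ln (1 + y n)\<close> by \<open>y n\<close>. It is
    quadratic in \<open>y n\<close>, hence of order \<open>h n ^ CARD('d)\<close> after scaling,
    because \<open>v n * G n\<close> converges.\<close>
  define w where "w n = (v n)\<^sup>2 / h n ^ ?d * (ln (1 + y n) - y n)" for n
  have w: "w \<longlonglongrightarrow> 0"
  proof (rule tendsto_rabs_zero_cancel, rule tendsto_sandwich[OF _ _ tendsto_const])
    show "\<forall>\<^sub>F n in sequentially. \<bar>w n\<bar> \<le> 2 * (v n * G n)\<^sup>2 * h n ^ ?d"
      using ysmall eventually_ge_at_top[of 1]
    proof eventually_elim
      case (elim n)
      have p: "v n > 0" "h n > 0" using v_pos h_pos elim by auto
      have "\<bar>w n\<bar> = (v n)\<^sup>2 / h n ^ ?d * \<bar>ln (1 + y n) - y n\<bar>"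
        using p by (simp add: w_def abs_mult)
      also have "\<dots> \<le> (v n)\<^sup>2 / h n ^ ?d * (2 * (y n)\<^sup>2)"
        using elim p by (intro mult_left_mono abs_ln_one_plus_x_minus_x_bound) auto
      also have "\<dots> = 2 * (v n * G n)\<^sup>2 * h n ^ ?d"
        using p by (simp add: y_def power_mult_distrib power2_eq_square field_simps)
      finally show ?case .
    qed
    have "(\<lambda>n. 2 * (v n * G n)\<^sup>2 * h n ^ ?d) \<longlonglongrightarrow> 2 * (l * f x)\<^sup>2 * 0"
      by (intro tendsto_intros vG hd)
    then show "(\<lambda>n. 2 * (v n * G n)\<^sup>2 * h n ^ ?d) \<longlonglongrightarrow> 0" by simp
  qed simp
  have "(\<lambda>n. w n + l * (v n * (m1 n - f x)) + l\<^sup>2 / 2 * m2 n + r n) \<longlonglongrightarrow> 0 + l * 0 + l\<^sup>2 / 2 * (kappa K * f x) + 0"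
    using bias by (intro tendsto_intros w m2 r) (simp add: m1_def)
  moreover have "\<forall>\<^sub>F n in sequentially.
    ln (expectation (\<lambda>\<omega>. exp (l * (real n * h n ^ ?d / (v n)\<^sup>2) * (v n * (kde K h X n x \<omega> - f x)))))
      / (real n * h n ^ ?d / (v n)\<^sup>2) = w n + l * (v n * (m1 n - f x)) + l\<^sup>2 / 2 * m2 n + r n"
    using ysmall eventually_ge_at_top[of 1]
  proof eventually_elim
    case (elim n)
    let ?b = "real n * h n ^ ?d"
    have p: "v n > 0" "h n > 0" using v_pos h_pos elim by auto
    have b: "?b > 0" using p elim by simp
    have "(\<lambda>\<omega>. exp (l * (?b / (v n)\<^sup>2) * (v n * (kde K h X n x \<omega> - f x)))) =
        (\<lambda>\<omega>. exp (l / v n * ?b * (kde K h X n x \<omega> - f x)))"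
    proof -
      have "l * (?b / (v n)\<^sup>2) * (v n * t) = l / v n * ?b * t" for t
        using p by (simp add: field_simps power2_eq_square)
      then show ?thesis by simp
    qed
    then have "expectation (\<lambda>\<omega>. exp (l * (?b / (v n)\<^sup>2) * (v n * (kde K h X n x \<omega> - f x)))) =
        (1 + y n) ^ n * exp (- (l / v n * ?b * f x))"
      using expectation_exp_kde[of n h "l / v n" "f x"] elim p by (simp add: y_def G_def)
    moreover have "1 + y n > 0" using elim by linarith
    ultimately have "ln (expectation (\<lambda>\<omega>. exp (l * (?b / (v n)\<^sup>2) * (v n * (kde K h X n x \<omega> - f x))))) =
        real n * ln (1 + y n) - l / v n * ?b * f x"
      by (simp add: ln_mult ln_realpow)
    also have "\<dots> / (?b / (v n)\<^sup>2) = (v n)\<^sup>2 / h n ^ ?d * ln (1 + y n) - l * v n * f x"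
      using p elim by (simp add: field_simps power2_eq_square)
    also have "\<dots> = w n + (v n)\<^sup>2 * G n - l * v n * f x"
      using p by (simp add: w_def y_def field_simps)
    also have "\<dots> = w n + l * (v n * (m1 n - f x)) + l\<^sup>2 / 2 * m2 n + r n"
      using p by (simp add: r_def field_simps power2_eq_square)
    finally show ?case .
  qed
  ultimately show ?thesis using tendsto_cong by (fastforce simp: mult_ac)
qed

end

section \<open>Logarithmic asymptotics of the noncoverage probability\<close>

locale kernel_confidence = kernel_sample M X f K x F B
  for M :: "'w measure" and X :: "nat \<Rightarrow> 'w \<Rightarrow> real ^ 'd" and f K x F B +
  fixes h h' v :: "nat \<Rightarrow> real" and \<delta> :: real
  assumes h_pos: "\<And>n. n \<ge> 1 \<Longrightarrow> 0 < h n" and h_lim: "h \<longlonglongrightarrow> 0"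
    and h'_pos: "\<And>n. n \<ge> 1 \<Longrightarrow> 0 < h' n" and h'_lim: "h' \<longlonglongrightarrow> 0"
    and v_pos: "\<And>n. n \<ge> 1 \<Longrightarrow> 0 < v n" and v_lim: "filterlim v at_top sequentially"
    and fx: "f x > 0"
    and bias_lim: "(\<lambda>n. v n * (smooth K (h' n) - f x)) \<longlonglongrightarrow> 0"
    and speed_lim: "filterlim (\<lambda>n. real n * h' n ^ CARD('d) / (v n)\<^sup>2) at_top sequentially"
    and ratio_lim: "filterlim (\<lambda>n. (v n)\<^sup>2 * h n ^ CARD('d) / h' n ^ CARD('d)) at_top sequentially"
    and \<delta>_pos: "0 < \<delta>"
begin

definition speed :: "nat \<Rightarrow> real"
  where "speed n = real n * h' n ^ CARD('d) / (v n)\<^sup>2"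

definition dev :: "nat \<Rightarrow> 'w \<Rightarrow> real"
  where "dev n \<omega> = v n * (kde K h' X n x \<omega> - f x)"

definition miss :: "nat \<Rightarrow> 'w set"
  where "miss n = {\<omega> \<in> space M. f x \<notin> conf_interval K h h' v X \<delta> x n \<omega>}"

lemma speed_at_top: "filterlim speed at_top sequentially"
  using speed_lim by (simp add: speed_def[abs_def])

lemma dev_measurable [measurable]: "dev n \<in> borel_measurable M"
  unfolding dev_def[abs_def] by measurable

lemma miss_measurable [measurable]: "miss n \<in> events"
  unfolding miss_def conf_interval_def atLeastAtMost_iff by measurable

lemma conf_interval_iff:
  assumes "n \<ge> 1"
  shows "f x \<in> conf_interval K h h' v X \<delta> x n \<omega> \<longleftrightarrow>
    \<bar>dev n \<omega>\<bar> \<le> \<delta> * sqrt (kde K h X n x \<omega> * kappa K)"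
proof -
  have v: "v n > 0" using v_pos assms by simp
  let ?r = "\<delta> * sqrt (kde K h X n x \<omega> * kappa K)"
  have "f x \<in> conf_interval K h h' v X \<delta> x n \<omega> \<longleftrightarrow> \<bar>kde K h' X n x \<omega> - f x\<bar> \<le> ?r / v n"
    by (auto simp: conf_interval_def abs_le_iff)
  also have "\<dots> \<longleftrightarrow> \<bar>dev n \<omega>\<bar> \<le> ?r"
    using v by (simp add: dev_def abs_mult pos_le_divide_eq mult.commute)
  finally show ?thesis .
qed

text \<open>The limit is even in \<open>l\<close>, so the sign \<open>\<sigma>\<close> can be
  absorbed into \<open>l\<close> and one statement serves both tails of \<open>dev\<close>.\<close>

lemma
  shows integrable_exp_dev: "integrable M (\<lambda>\<omega>. exp (l * speed n * (\<sigma> * dev n \<omega>)))"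
    and dev_log_mgf_tendsto: "\<bar>\<sigma>\<bar> = 1 \<Longrightarrow>
      (\<lambda>n. ln (expectation (\<lambda>\<omega>. exp (l * speed n * (\<sigma> * dev n \<omega>)))) / speed n)
        \<longlonglongrightarrow> (kappa K * f x) * l\<^sup>2 / 2"
proof -
  show "integrable M (\<lambda>\<omega>. exp (l * speed n * (\<sigma> * dev n \<omega>)))"
    using integrable_exp_kde[where p = "l * speed n * \<sigma> * v n" and h = h' and n = n
        and q = "- (l * speed n * \<sigma> * v n * f x)"]
    by (simp add: dev_def algebra_simps)
next
  assume "\<bar>\<sigma>\<bar> = 1"
  then have sq: "(l * \<sigma>)\<^sup>2 = l\<^sup>2"
    by (metis abs_mult mult.right_neutral power2_abs)
  have eq: "l * speed n * (\<sigma> * dev n \<omega>) = (l * \<sigma>) * speed n * dev n \<omega>" for n \<omega> by simp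
  show "(\<lambda>n. ln (expectation (\<lambda>\<omega>. exp (l * speed n * (\<sigma> * dev n \<omega>)))) / speed n)
        \<longlonglongrightarrow> (kappa K * f x) * l\<^sup>2 / 2"
    using kde_log_mgf_tendsto[OF h'_pos h'_lim v_pos v_lim bias_lim, of "l * \<sigma>"]
    unfolding sq eq speed_def[symmetric] dev_def[symmetric] .
qed

text \<open>The estimator with bandwidth \<open>h\<close> concentrates at speed \<open>n * h n ^ d\<close>, which is of larger order
  than \<open>speed n\<close>, so replacing it by \<open>f x\<close> is free of charge on the scale of moderate deviations.\<close>

lemma kde_tail_superexponential:
  assumes e: "e > 0" and \<sigma>: "\<bar>\<sigma>\<bar> = 1"
  shows "\<forall>\<^sub>F n in sequentially.
    prob {\<omega> \<in> space M. \<sigma> * (kde K h X n x \<omega> - f x) \<ge> e} \<le> exp (- speed n * C)"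
proof -
  obtain \<eta> where \<eta>: "\<eta> > 0" and ev: "\<forall>\<^sub>F n in sequentially.
      prob {\<omega> \<in> space M. \<sigma> * (kde K h X n x \<omega> - f x) \<ge> e} \<le> exp (- (real n * h n ^ CARD('d)) * \<eta>)"
    using kde_tail[OF h_pos h_lim e \<sigma>] by blast
  have "\<forall>\<^sub>F n in sequentially. (v n)\<^sup>2 * h n ^ CARD('d) / h' n ^ CARD('d) > C / \<eta>"
    using ratio_lim by (simp add: filterlim_at_top_dense)
  from ev this eventually_ge_at_top[of "1::nat"] show ?thesis
  proof eventually_elim
    case (elim n)
    have p: "v n > 0" "h' n > 0" using v_pos h'_pos elim by auto
    then have sp: "speed n > 0" using elim by (simp add: speed_def)
    have "speed n * C \<le> speed n * (\<eta> * ((v n)\<^sup>2 * h n ^ CARD('d) / h' n ^ CARD('d)))"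
      using elim(2) \<eta> sp by (intro mult_left_mono) (simp_all add: pos_divide_less_eq mult.commute)
    also have "\<dots> = real n * h n ^ CARD('d) * \<eta>"
      using p by (simp add: speed_def)
    finally show ?case using elim(1) by (smt (verit) exp_le_cancel_iff mult_minus_left)
  qed
qed

text \<open>When \<open>f x\<close> is missed, either the width estimator is at most
  \<open>f x - e\<close>, or one of the two tails of \<open>dev\<close> exceeds the width computed
  with \<open>f x - e\<close>. The first event is superexponentially small; letting \<open>e\<close>
  tend to 0 recovers the rate.\<close>

lemma miss_upper_bound:
  assumes c: "c < \<delta>\<^sup>2 / 2"
  shows "\<forall>\<^sub>F n in sequentially. prob (miss n) \<le> exp (- speed n * c)"
proof -
  \<comment> \<open>The gap between \<open>c\<close> and \<open>c'\<close> absorbs the factor 3 of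
    the union bound: once \<open>speed n * (c' - c) > 2\<close>, its exponential is at least
    3.\<close>
  obtain c' where c': "c < c'" "c' < \<delta>\<^sup>2 / 2" using dense[OF c] by blast
  have "((\<lambda>e. \<delta>\<^sup>2 * (f x - e) / (2 * f x)) \<longlongrightarrow> \<delta>\<^sup>2 * (f x - 0) / (2 * f x)) (at_right 0)"
    using fx by (intro tendsto_intros) auto
  then have "\<forall>\<^sub>F e in at_right 0. \<delta>\<^sup>2 * (f x - e) / (2 * f x) > c'"
    using c' fx by (intro order_tendstoD) (auto simp: field_simps)
  moreover have "\<forall>\<^sub>F e in at_right 0. 0 < e \<and> e < f x"
    using fx eventually_at_right_field by blast
  ultimately obtain e where ec: "\<delta>\<^sup>2 * (f x - e) / (2 * f x) > c'" and e: "0 < e" "e < f x"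
    using eventually_happens[OF eventually_conj] by fastforce
  define t where "t = \<delta> * sqrt ((f x - e) * kappa K)"
  have t: "t > 0" using \<delta>_pos e kappa_pos by (simp add: t_def)
  have "t\<^sup>2 / (2 * (kappa K * f x)) = \<delta>\<^sup>2 * (f x - e) / (2 * f x)"
    using e kappa_pos fx by (simp add: t_def power_mult_distrib)
  then have tc: "c' < t\<^sup>2 / (2 * (kappa K * f x))" using ec by simp
  have s: "kappa K * f x > 0" using kappa_pos fx by simp
  have tail: "\<forall>\<^sub>F n in sequentially. prob {\<omega> \<in> space M. \<sigma> * dev n \<omega> \<ge> t} \<le> exp (- speed n * c')"
    if "\<bar>\<sigma>\<bar> = 1" for \<sigma>
    using gaussian_mgf_upper_tail[OF speed_at_top integrable_exp_dev dev_log_mgf_tendsto[OF that] s t tc] .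
  have big: "\<forall>\<^sub>F n in sequentially. speed n > 2 / (c' - c)"
    using speed_at_top by (simp add: filterlim_at_top_dense)
  have "\<bar>1 :: real\<bar> = 1" "\<bar>-1 :: real\<bar> = 1" by auto
  from tail[OF this(1)] tail[OF this(2)] kde_tail_superexponential[OF e(1) this(2), of c']
    big eventually_ge_at_top[of "1::nat"] show ?thesis
  proof eventually_elim
    case (elim n)
    let ?A = "{\<omega> \<in> space M. 1 * dev n \<omega> \<ge> t}" and ?B = "{\<omega> \<in> space M. -1 * dev n \<omega> \<ge> t}"
      and ?C = "{\<omega> \<in> space M. -1 * (kde K h X n x \<omega> - f x) \<ge> e}"
    have "miss n \<subseteq> ?A \<union> ?B \<union> ?C"
    proof
      fix \<omega> assume "\<omega> \<in> miss n"
      then have \<omega>: "\<omega> \<in> space M" and dev: "\<bar>dev n \<omega>\<bar> > \<delta> * sqrt (kde K h X n x \<omega> * kappa K)"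
        using conf_interval_iff[OF elim(5), of \<omega>] by (auto simp: miss_def)
      show "\<omega> \<in> ?A \<union> ?B \<union> ?C"
      proof (cases "kde K h X n x \<omega> \<le> f x - e")
        case False
        then have "t \<le> \<delta> * sqrt (kde K h X n x \<omega> * kappa K)"
          unfolding t_def using \<delta>_pos kappa_pos
          by (intro mult_left_mono real_sqrt_le_mono mult_right_mono) auto
        then show ?thesis using \<omega> dev by auto
      qed (use \<omega> in auto)
    qed
    then have "prob (miss n) \<le> prob (?A \<union> ?B \<union> ?C)"
      by (rule finite_measure_mono) measurable
    also have "\<dots> \<le> prob ?A + prob ?B + prob ?C"
      by (rule measure_Un_le[THEN order_trans], measurable)
        (intro add_mono order_refl measure_Un_le; measurable)
    also have "\<dots> \<le> 3 * exp (- speed n * c')" using elim by linarith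
    also have "\<dots> \<le> exp (speed n * (c' - c)) * exp (- speed n * c')"
    proof (rule mult_right_mono)
      have "speed n * (c' - c) > 2" using elim(4) c' by (simp add: field_simps)
      then show "3 \<le> exp (speed n * (c' - c))"
        using exp_ge_add_one_self[of "speed n * (c' - c)"] by linarith
    qed simp
    also have "\<dots> = exp (- speed n * c)" by (simp add: algebra_simps flip: exp_add)
    finally show ?case .
  qed
qed

text \<open>A single tail is enough at logarithmic scale. If \<open>dev\<close> exceeds the width
  computed with \<open>f x + e\<close>, then \<open>f x\<close> is missed unless the width estimator
  is at least \<open>f x + e\<close>.\<close>

lemma miss_lower_bound:
  assumes c: "c > \<delta>\<^sup>2 / 2"
  shows "\<forall>\<^sub>F n in sequentially. exp (- speed n * c) \<le> prob (miss n)"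
proof -
  obtain c' where c': "c' < c" "\<delta>\<^sup>2 / 2 < c'" using dense[OF c] by blast
  have "((\<lambda>e. \<delta>\<^sup>2 * (f x + e) / (2 * f x)) \<longlongrightarrow> \<delta>\<^sup>2 * (f x + 0) / (2 * f x)) (at_right 0)"
    using fx by (intro tendsto_intros) auto
  then have "\<forall>\<^sub>F e in at_right 0. \<delta>\<^sup>2 * (f x + e) / (2 * f x) < c'"
    using c' fx by (intro order_tendstoD) (auto simp: field_simps)
  moreover have "\<forall>\<^sub>F e in at_right (0::real). 0 < e"
    by (simp add: eventually_at_right_less)
  ultimately obtain e where ec: "\<delta>\<^sup>2 * (f x + e) / (2 * f x) < c'" and e: "0 < e"
    using eventually_happens[OF eventually_conj] by fastforce
  define t where "t = \<delta> * sqrt ((f x + e) * kappa K)"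
  have t: "t > 0" using \<delta>_pos e kappa_pos fx by (simp add: t_def)
  have "t\<^sup>2 / (2 * (kappa K * f x)) = \<delta>\<^sup>2 * (f x + e) / (2 * f x)"
    using e kappa_pos fx by (simp add: t_def power_mult_distrib)
  then have tc: "c' > t\<^sup>2 / (2 * (kappa K * f x))" using ec by simp
  have s: "kappa K * f x > 0" using kappa_pos fx by simp
  have sg: "\<bar>1 :: real\<bar> = 1" by simp
  have tail: "\<forall>\<^sub>F n in sequentially. exp (- speed n * c') \<le> prob {\<omega> \<in> space M. 1 * dev n \<omega> > t}"
    using gaussian_mgf_lower_tail[OF speed_at_top integrable_exp_dev _ dev_log_mgf_tendsto[OF sg] s t tc]
    by simp
  have big: "\<forall>\<^sub>F n in sequentially. speed n > 1 / (c - c')"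
    using speed_at_top by (simp add: filterlim_at_top_dense)
  \<comment> \<open>The exceptional event is bounded at rate \<open>c\<close>, faster than the rate
    \<open>c'\<close> of the main tail. Once \<open>speed n * (c - c') > 1\<close>, subtracting it
    removes at most half of the main term.\<close>
  from tail kde_tail_superexponential[OF e sg, of c] big eventually_ge_at_top[of "1::nat"] show ?thesis
  proof eventually_elim
    case (elim n)
    let ?A = "{\<omega> \<in> space M. 1 * dev n \<omega> > t}"
      and ?C = "{\<omega> \<in> space M. 1 * (kde K h X n x \<omega> - f x) \<ge> e}"
    have "?A \<subseteq> miss n \<union> ?C"
    proof
      fix \<omega> assume "\<omega> \<in> ?A"
      then have \<omega>: "\<omega> \<in> space M" and dev: "dev n \<omega> > t" by auto
      show "\<omega> \<in> miss n \<union> ?C"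
      proof (cases "kde K h X n x \<omega> \<ge> f x + e")
        case False
        then have "\<delta> * sqrt (kde K h X n x \<omega> * kappa K) \<le> t"
          unfolding t_def using \<delta>_pos kappa_pos
          by (intro mult_left_mono real_sqrt_le_mono mult_right_mono) auto
        then show ?thesis using \<omega> dev conf_interval_iff[OF elim(4), of \<omega>] by (auto simp: miss_def)
      qed (use \<omega> in auto)
    qed
    then have "prob ?A \<le> prob (miss n \<union> ?C)"
      by (rule finite_measure_mono) measurable
    also have "\<dots> \<le> prob (miss n) + prob ?C"
      by (rule measure_Un_le) measurable
    finally have "exp (- speed n * c') - exp (- speed n * c) \<le> prob (miss n)"
      using elim by linarith
    moreover have "2 * exp (- speed n * c) \<le> exp (- speed n * c')"
    proof -
      have "speed n * (c - c') > 1" using elim(3) c' by (simp add: field_simps)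
      then have "2 \<le> exp (speed n * (c - c'))"
        using exp_ge_add_one_self[of "speed n * (c - c')"] by linarith
      then have "2 * exp (- speed n * c) \<le> exp (speed n * (c - c')) * exp (- speed n * c)"
        by (intro mult_right_mono) auto
      also have "\<dots> = exp (- speed n * c')" by (simp add: algebra_simps flip: exp_add)
      finally show ?thesis .
    qed
    ultimately show ?case by linarith
  qed
qed

lemma miss_log_tendsto: "(\<lambda>n. ln (prob (miss n)) / speed n) \<longlonglongrightarrow> - (\<delta>\<^sup>2 / 2)"
proof (rule order_tendstoI)
  have sp: "\<forall>\<^sub>F n in sequentially. speed n > 0"
    using speed_at_top by (simp add: filterlim_at_top_dense)
  \<comment> \<open>The lower bound excludes probability 0, where \<open>ln\<close> takes a default
    value and the inequalities below would fail to translate.\<close>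
  have pos: "\<forall>\<^sub>F n in sequentially. prob (miss n) > 0"
  proof -
    have "\<forall>\<^sub>F n in sequentially. exp (- speed n * (\<delta>\<^sup>2 / 2 + 1)) \<le> prob (miss n)"
      by (intro miss_lower_bound) simp
    then show ?thesis by eventually_elim (use exp_gt_zero less_le_trans in blast)
  qed
  fix q
  {
    assume "q < - (\<delta>\<^sup>2 / 2)"
    then obtain c where c: "q < - c" "\<delta>\<^sup>2 / 2 < c"
      using dense[of q "- (\<delta>\<^sup>2 / 2)"] by (metis minus_less_iff minus_minus)
    from miss_lower_bound[OF c(2)] sp pos show "\<forall>\<^sub>F n in sequentially. q < ln (prob (miss n)) / speed n"
    proof eventually_elim
      case (elim n)
      have "- speed n * c \<le> ln (prob (miss n))" using elim by (simp add: ln_ge_iff)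
      then have "- c \<le> ln (prob (miss n)) / speed n" using elim by (simp add: field_simps)
      then show ?case using c by linarith
    qed
  next
    assume "q > - (\<delta>\<^sup>2 / 2)"
    then obtain c where c: "q > - c" "\<delta>\<^sup>2 / 2 > c"
      using dense[of "- (\<delta>\<^sup>2 / 2)" q] by (metis minus_less_iff minus_minus)
    from miss_upper_bound[OF c(2)] sp pos show "\<forall>\<^sub>F n in sequentially. ln (prob (miss n)) / speed n < q"
    proof eventually_elim
      case (elim n)
      have "ln (prob (miss n)) \<le> - speed n * c" using elim by (metis ln_exp ln_le_cancel_iff exp_gt_zero)
      then have "ln (prob (miss n)) / speed n \<le> - c" using elim by (simp add: field_simps)
      then show ?case using c by linarith
    qed
  }
qed

section \<open>Almost sure coverage\<close>

text \<open>No upper bound on \<open>h'\<close> is assumed, so \<open>ln (1 / h' n)\<close> need not be comparable to \<open>ln n\<close>. But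
  \<open>v n \<le> (h' n) powr - 2\<close> eventually, so \<open>speed n \<ge> n * h' n ^ (d + 4)\<close>: either \<open>h' n\<close> is below a power
  of \<open>1 / n\<close> and the logarithmic condition applies, or \<open>speed n \<ge> sqrt n\<close>.\<close>

lemma speed_dominates_ln:
  assumes bw: "(\<lambda>n. v n * (h' n)\<^sup>2) \<longlonglongrightarrow> 0"
    and log_speed: "filterlim (\<lambda>n. real n * h' n ^ CARD('d) / ((v n)\<^sup>2 * ln (1 / h' n))) at_top sequentially"
  shows "\<forall>\<^sub>F n in sequentially. C * ln (real n) \<le> speed n"
proof -
  define m where "m = CARD('d) + 4"
  have v1: "\<forall>\<^sub>F n in sequentially. v n * (h' n)\<^sup>2 < 1"
    using bw by (rule order_tendstoD) simp
  have h1: "\<forall>\<^sub>F n in sequentially. h' n < 1"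
    using h'_lim by (rule order_tendstoD) simp
  have A: "\<forall>\<^sub>F n in sequentially. real n * h' n ^ CARD('d) / ((v n)\<^sup>2 * ln (1 / h' n)) > \<bar>C\<bar> * (2 * m)"
    using log_speed by (simp add: filterlim_at_top_dense)
  have S: "\<forall>\<^sub>F n in sequentially. C * ln (real n) \<le> sqrt (real n)"
    by real_asymp
  from v1 h1 A S eventually_ge_at_top[of "1::nat"] show ?thesis
  proof eventually_elim
    case (elim n)
    have p: "v n > 0" "h' n > 0" "n > 0" using v_pos h'_pos elim by auto
    show ?case
    \<comment> \<open>The threshold makes both cases work: below it
      \<open>ln (real n) \<le> (2 * m) * ln (1 / h' n)\<close>, which explains the constant
      \<open>\<bar>C\<bar> * (2 * m)\<close>; above it
      \<open>h' n ^ m \<ge> 1 / sqrt (real n)\<close>.\<close>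
    proof (cases "h' n ^ (2 * m) < 1 / real n")
      case True
      then have "real n \<le> (1 / h' n) ^ (2 * m)"
        using p by (simp add: power_divide field_simps)
      then have "ln (real n) \<le> ln ((1 / h' n) ^ (2 * m))" using p by simp
      also have "\<dots> = (2 * m) * ln (1 / h' n)" using p by (subst ln_realpow) auto
      finally have "\<bar>C\<bar> * ln (real n) \<le> \<bar>C\<bar> * ((2 * m) * ln (1 / h' n))" by (intro mult_left_mono) auto
      moreover have L: "ln (1 / h' n) > 0" using p elim by simp
      have "speed n / ln (1 / h' n) > \<bar>C\<bar> * (2 * m)" using elim(3) by (simp add: speed_def)
      then have "speed n > (\<bar>C\<bar> * (2 * m)) * ln (1 / h' n)" using L by (simp add: pos_less_divide_eq)
      moreover have "C * ln (real n) \<le> \<bar>C\<bar> * ln (real n)" using p by (intro mult_right_mono) auto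
      ultimately show ?thesis by (simp add: mult.assoc)
    next
      case False
      have "sqrt (1 / real n) \<le> sqrt ((h' n ^ m)\<^sup>2)"
        using False by (intro real_sqrt_le_mono) (simp add: power_mult[symmetric] mult.commute)
      then have hm: "sqrt (1 / real n) \<le> h' n ^ m" using p by simp
      have "sqrt (real n) = real n * sqrt (1 / real n)"
        using p by (simp add: real_sqrt_divide real_div_sqrt)
      also have "\<dots> \<le> real n * h' n ^ m" using hm by (intro mult_left_mono) auto
      also have "\<dots> = real n * h' n ^ CARD('d) / (v n)\<^sup>2 * (v n * (h' n)\<^sup>2)\<^sup>2"
        using p by (simp add: m_def power_add power_mult_distrib power_mult[symmetric])
      also have "\<dots> \<le> speed n * 1"
      proof -
        have "(v n * (h' n)\<^sup>2)\<^sup>2 \<le> 1" using elim(1) p by (intro power_le_one) auto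
        then show ?thesis unfolding speed_def using p by (intro mult_left_mono) auto
      qed
      finally show ?thesis using elim(4) by linarith
    qed
  qed
qed

lemma miss_as_confidence_regions:
  assumes "(\<lambda>n. v n * (h' n)\<^sup>2) \<longlonglongrightarrow> 0"
    and "filterlim (\<lambda>n. real n * h' n ^ CARD('d) / ((v n)\<^sup>2 * ln (1 / h' n))) at_top sequentially"
  shows "as_confidence_regions M (f x) (conf_interval K h h' v X \<delta> x)"
proof -
  \<comment> \<open>Any positive rate below \<open>\<delta>\<^sup>2 / 2\<close> would do. With rate
    \<open>\<delta>\<^sup>2 / 4\<close>, domination of \<open>ln\<close> with constant
    \<open>2 / (\<delta>\<^sup>2 / 4)\<close> yields the summable bound
    \<open>1 / real n ^ 2\<close>.\<close>
  have "\<forall>\<^sub>F n in sequentially. prob (miss n) \<le> exp (- speed n * (\<delta>\<^sup>2 / 4))"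
    using \<delta>_pos by (intro miss_upper_bound) (simp add: field_simps)
  with speed_dominates_ln[OF assms, of "2 / (\<delta>\<^sup>2 / 4)"] eventually_ge_at_top[of "1::nat"]
  have "\<forall>\<^sub>F n in sequentially. norm (prob (miss n)) \<le> 1 / real n ^ 2"
  proof eventually_elim
    case (elim n)
    have "2 * ln (real n) \<le> speed n * (\<delta>\<^sup>2 / 4)"
      using elim(1) \<delta>_pos by (simp add: field_simps)
    then have "exp (- speed n * (\<delta>\<^sup>2 / 4)) \<le> exp (- (2 * ln (real n)))"
      unfolding exp_le_cancel_iff by linarith
    also have "\<dots> = 1 / real n ^ 2"
    proof -
      have "exp (2 * ln (real n)) = exp (ln (real n)) ^ 2" by (simp add: exp_double)
      also have "\<dots> = real n ^ 2" using elim by simp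
      finally show ?thesis by (simp only: exp_minus inverse_eq_divide)
    qed
    finally show ?case using elim by simp
  qed
  then have "summable (\<lambda>n. prob (miss n))"
    by (rule summable_comparison_test_ev) (use inverse_power_summable[of 2] in \<open>simp add: field_simps\<close>)
  then have "AE \<omega> in M. \<forall>\<^sub>F n in sequentially. \<omega> \<in> space M - miss n"
    by (intro borel_cantelli_AE1) (auto simp: emeasure_eq_measure)
  then obtain S where S: "S \<subseteq> {\<omega> \<in> space M. \<forall>\<^sub>F n in sequentially. \<omega> \<in> space M - miss n}"
      "S \<in> events" "prob S = 1"
    by (rule AE_E_prob)
  then show ?thesis
    unfolding as_confidence_regions_def
    by (intro bexI[of _ S]) (auto simp: miss_def eventually_sequentially subset_eq, fastforce)
qed

end

section \<open>From the stated hypotheses to the moderate deviation setting\<close>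

theorem theorem1:
  fixes M :: "'w measure"
    and X :: "nat \<Rightarrow> 'w \<Rightarrow> real ^ 'd"
    and f K :: "real ^ 'd \<Rightarrow> real"
    and h h' v :: "nat \<Rightarrow> real"
    and x :: "real ^ 'd"
    and \<delta> :: real
  assumes "prob_space M"
    and "prob_space.indep_vars M (\<lambda>_. borel) X {1..}"
    and "\<And>j. j \<ge> 1 \<Longrightarrow> distributed M lborel (X j) (\<lambda>y. ennreal (f y))"
    and "\<And>y. 0 \<le> f y" and "bounded (range f)"
    and "\<And>z. 0 \<le> K z" and "bounded (range K)"
    and "integrable lborel K" and "(LINT z|lborel. K z) = 1"
    and "(K \<longlongrightarrow> 0) at_infinity"
    and "\<And>j. (LINT z|lborel. z $ j * K z) = 0"
    and "integrable lborel (\<lambda>z. (norm z)\<^sup>2 * \<bar>K z\<bar>)"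
    and "\<And>n. n \<ge> 1 \<Longrightarrow> 0 < h n" and "h \<longlonglongrightarrow> 0"
    and "\<And>n. n \<ge> 1 \<Longrightarrow> 0 < h' n" and "h' \<longlonglongrightarrow> 0"
    and "\<And>n. n \<ge> 1 \<Longrightarrow> 0 < v n" and "filterlim v at_top sequentially"
    and "f x \<noteq> 0" and "twice_differentiable_at f x"
    and "filterlim (\<lambda>n. real n * h' n ^ CARD('d) / (v n)\<^sup>2) at_top sequentially"
    and "(\<lambda>n. v n * (h' n)\<^sup>2) \<longlonglongrightarrow> 0"
    and "filterlim (\<lambda>n. (v n)\<^sup>2 * h n ^ CARD('d) / h' n ^ CARD('d)) at_top sequentially"
    and "0 < \<delta>"
  shows "((\<lambda>n. (v n)\<^sup>2 / (real n * h' n ^ CARD('d)) *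
             ln (measure M {\<omega> \<in> space M. f x \<notin> conf_interval K h h' v X \<delta> x n \<omega>}))
           \<longlonglongrightarrow> - (\<delta>\<^sup>2 / 2)) \<and>
         (filterlim (\<lambda>n. real n * h' n ^ CARD('d) / ((v n)\<^sup>2 * ln (1 / h' n))) at_top sequentially
           \<longrightarrow> as_confidence_regions M (f x) (conf_interval K h h' v X \<delta> x))"
proof -
  obtain F where F: "\<And>y. f y \<le> F"
    using assms(4,5) by (auto simp: bounded_iff)
  obtain B where B: "\<And>z. K z \<le> B"
    using assms(6,7) by (auto simp: bounded_iff)
  \<comment> \<open>A property that holds eventually in \<open>nhds x\<close> holds at
    \<open>x\<close> itself, so \<open>f\<close> has a derivative there.\<close>
  have cont: "isCont f x"
    using assms(20) eventually_nhds_x_imp_x has_derivative_continuous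
    by (fastforce simp: twice_differentiable_at_def)
  interpret kernel_sample M X f K x F B
    using assms F B cont by (simp add: kernel_sample_def kernel_sample_axioms_def)
  obtain C where C: "\<And>c. \<bar>smooth K c - f x\<bar> \<le> C * c\<^sup>2"
    using smooth_K_bias[OF assms(11,12,20)] by blast
  have bias: "(\<lambda>n. v n * (smooth K (h' n) - f x)) \<longlonglongrightarrow> 0"
  proof (rule tendsto_rabs_zero_cancel, rule tendsto_sandwich[OF _ _ tendsto_const])
    show "\<forall>\<^sub>F n in sequentially. \<bar>v n * (smooth K (h' n) - f x)\<bar> \<le> C * (v n * (h' n)\<^sup>2)"
      using eventually_ge_at_top[of "1::nat"]
    proof eventually_elim
      case (elim n)
      have "v n * \<bar>smooth K (h' n) - f x\<bar> \<le> v n * (C * (h' n)\<^sup>2)"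
        using C assms(17)[OF elim] by (intro mult_left_mono) auto
      then show ?case using assms(17)[OF elim] by (simp add: abs_mult mult_ac)
    qed
    show "(\<lambda>n. C * (v n * (h' n)\<^sup>2)) \<longlonglongrightarrow> 0"
      using tendsto_mult[OF tendsto_const assms(22)] by simp
  qed simp
  have "f x > 0" using assms(4)[of x] assms(19) by simp
  then interpret kernel_confidence M X f K x F B h h' v \<delta>
    using assms bias by unfold_locales auto
  show ?thesis
    using miss_log_tendsto miss_as_confidence_regions[OF assms(22)] by (simp add: miss_def speed_def mult.commute)
qed

end
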